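(* Let $k$ be a field with $\operatorname{char}(k)\ne2$. Suppose a finite group $G$ acts linearly on a finite dimensional vector space $V$ over $k$, and the characteristic of $k$ is coprime to $|G|$ (i.e. does not divide $|G|$). If the algebra $\mathcal{H}_{\lambda,\kappa}$ is a PBW deformation of $S(V)\rtimes G$ for some (bilinear) parameter functions $$\lambda:kG\times V\to kG\quad\text{and}\quad\kappa:V\times V\to kG\oplus(V\otimes kG),$$ then there exists a (bilinear) parameter function $$\kappa':V\times V\to kG\oplus(V\otimes kG)$$ such that $$\mathcal{H}_{\lambda,\kappa}\cong\mathcal{H}_{0,\kappa'}$$ as filtered algebras, and thus $\mathcal{H}_{0,\kappa'}$ also exhibits the PBW property.
   Context: ${}^gv$ denotes the action of $g\in G$ on $v\in V$. $S(V)$ is the symmetric algebra and $S(V)\rtimes G$ the skew group algebra, generated by $kG$ and $V$ with relations $vw=wv$ and $gv={}^gv\,g$, graded with $G$ in degree $0$ and $V$ in degree $1$. For bilinear $\lambda:kG\times V\to kG$ and $\kappa:V\times V\to kG\oplus(V\otimes kG)$, $\mathcal{H}_{\lambda,\kappa}$ is the $k$-algebra generated by the group ring $kG$ together with $V$ subject to the relations $$gv-{}^gv\,g-\lambda(g,v)\quad(g\in G,\ v\in V),\qquad vw-wv-\kappa(v,w)\quad(v,w\in V),$$ where $v\otimes g\in V\otimes kG$ is read as the product $vg$. It is filtered with $kG$ in degree $0$ and $V$ in degree $1$. It is a PBW deformation of $S(V)\rtimes G$ (exhibits the PBW property) if its associated graded algebra is isomorphic to $S(V)\rtimes G$ as a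 graded algebra. $\mathcal H_{0,\kappa'}$ is the case $\lambda=0$. *)

theory Defs
  imports "HOL-Algebra.Algebra" "HOL-Library.Poly_Mapping" "HOL-Library.Product_Plus"
begin

section \<open>Linear algebra\<close>

definition bilinear_map ::
    "('k::field \<Rightarrow> 'a::ab_group_add \<Rightarrow> 'a) \<Rightarrow> ('k \<Rightarrow> 'b::ab_group_add \<Rightarrow> 'b) \<Rightarrow>
     ('k \<Rightarrow> 'c::ab_group_add \<Rightarrow> 'c) \<Rightarrow> ('a \<Rightarrow> 'b \<Rightarrow> 'c) \<Rightarrow> bool" where
  "bilinear_map s1 s2 s3 f \<longleftrightarrow>
     (\<forall>x. Vector_Spaces.linear s2 s3 (f x)) \<and> (\<forall>y. Vector_Spaces.linear s1 s3 (\<lambda>x. f x y))"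

text \<open>
  Groups are types of class \<^class>\<open>group_add\<close>, which is not assumed to be commutative. So the
  product \<open>gh\<close> is written \<open>g + h\<close>, the identity is \<open>0\<close>, and the group algebra \<open>kG\<close> is the type
  \<open>'g \<Rightarrow>\<^sub>0 'k\<close> with its convolution product, the group element \<open>g\<close> being
  \<open>Poly_Mapping.single g 1\<close>.
\<close>

definition linear_action ::
    "('k::field \<Rightarrow> 'v::ab_group_add \<Rightarrow> 'v) \<Rightarrow> ('g::group_add \<Rightarrow> 'v \<Rightarrow> 'v) \<Rightarrow> bool" where
  "linear_action sV act \<longleftrightarrow>
     (\<forall>g. Vector_Spaces.linear sV sV (act g)) \<and>
     act 0 = id \<and> (\<forall>g h. act (g + h) = act g \<circ> act h)"

definition coeff_scale :: "('k \<Rightarrow> 'a \<Rightarrow> 'a) \<Rightarrow> 'k \<Rightarrow> ('x \<Rightarrow>\<^sub>0 'a::zero) \<Rightarrow> ('x \<Rightarrow>\<^sub>0 'a)" where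
  "coeff_scale s c p = Poly_Mapping.map (s c) p"

text \<open>
  \<open>V \<otimes> kG\<close> is modelled as \<open>'g \<Rightarrow>\<^sub>0 'v\<close>, with \<open>v \<otimes> g\<close> being \<open>Poly_Mapping.single g v\<close>: since the
  group elements are a basis of \<open>kG\<close>, every tensor is a unique sum \<open>\<Sum>\<^sub>g v\<^sub>g \<otimes> g\<close>. Hence
  \<open>kG \<oplus> (V \<otimes> kG)\<close> is \<open>('g \<Rightarrow>\<^sub>0 'k) \<times> ('g \<Rightarrow>\<^sub>0 'v)\<close>, with the following scalar multiplication.
\<close>

definition kappa_scale ::
    "('k::field \<Rightarrow> 'v::ab_group_add \<Rightarrow> 'v) \<Rightarrow> 'k \<Rightarrow>
     ('g \<Rightarrow>\<^sub>0 'k) \<times> ('g \<Rightarrow>\<^sub>0 'v) \<Rightarrow> ('g \<Rightarrow>\<^sub>0 'k) \<times> ('g \<Rightarrow>\<^sub>0 'v)" where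
  "kappa_scale sV c p = (coeff_scale (*) c (fst p), coeff_scale sV c (snd p))"


section \<open>Filtered and graded algebras\<close>

text \<open>
  A (not necessarily commutative) \<open>k\<close>-algebra is a record of type \<^typ>\<open>('k, 'a) module\<close>. A filtration
  or a grading on it is a family \<open>nat \<Rightarrow> 'a set\<close> of subspaces.
\<close>

definition quot_algebra :: "('k, 'a) module \<Rightarrow> 'a set \<Rightarrow> ('k, 'a set) module" where
  "quot_algebra A I =
     ring.extend (A Quot I) (module.fields (\<lambda>c C. \<Union>x\<in>C. I +>\<^bsub>A\<^esub> (c \<odot>\<^bsub>A\<^esub> x)))"

definition algebra_iso :: "('k, 'a) module \<Rightarrow> ('k, 'b) module \<Rightarrow> ('a \<Rightarrow> 'b) set" where
  "algebra_iso A B =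
     {\<phi> \<in> ring_iso A B. \<forall>c. \<forall>x\<in>carrier A. \<phi> (c \<odot>\<^bsub>A\<^esub> x) = c \<odot>\<^bsub>B\<^esub> \<phi> x}"

definition filtered_isomorphic ::
    "('k, 'a) module \<Rightarrow> (nat \<Rightarrow> 'a set) \<Rightarrow> ('k, 'b) module \<Rightarrow> (nat \<Rightarrow> 'b set) \<Rightarrow> bool" where
  "filtered_isomorphic A F B E \<longleftrightarrow> (\<exists>\<phi>\<in>algebra_iso A B. \<forall>n. \<phi> ` F n = E n)"

definition graded_isomorphic ::
    "('k, 'a) module \<Rightarrow> (nat \<Rightarrow> 'a set) \<Rightarrow> ('k, 'b) module \<Rightarrow> (nat \<Rightarrow> 'b set) \<Rightarrow> bool" where
  "graded_isomorphic A D B E \<longleftrightarrow> (\<exists>\<phi>\<in>algebra_iso A B. \<forall>n. \<phi> ` D n = E n)"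

text \<open>\<open>filt_below A F n\<close> is \<open>F\<^sub>n\<^sub>-\<^sub>1\<close>, with \<open>F\<^sub>-\<^sub>1 = 0\<close>.\<close>

definition filt_below :: "('k, 'a) module \<Rightarrow> (nat \<Rightarrow> 'a set) \<Rightarrow> nat \<Rightarrow> 'a set" where
  "filt_below A F n = (case n of 0 \<Rightarrow> {\<zero>\<^bsub>A\<^esub>} | Suc m \<Rightarrow> F m)"

text \<open>
  The associated graded algebra \<open>\<Oplus>\<^sub>n F\<^sub>n / F\<^sub>n\<^sub>-\<^sub>1\<close>. Its elements are the sequences \<open>a\<close> of cosets
  \<open>a n \<in> F\<^sub>n / F\<^sub>n\<^sub>-\<^sub>1\<close> almost all of which are zero (i.e. equal to \<open>F\<^sub>n\<^sub>-\<^sub>1\<close>). The product is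
  induced by \<open>(x + F\<^sub>i\<^sub>-\<^sub>1)(y + F\<^sub>j\<^sub>-\<^sub>1) = xy + F\<^sub>i\<^sub>+\<^sub>j\<^sub>-\<^sub>1\<close>; as \<open>A A_Mod F\<^sub>n\<^sub>-\<^sub>1\<close> is the additive group
  \<open>A / F\<^sub>n\<^sub>-\<^sub>1\<close> in multiplicative notation, its \<^const>\<open>finprod\<close> is the sum of the cosets.
\<close>

definition assoc_graded ::
    "('k, 'a) module \<Rightarrow> (nat \<Rightarrow> 'a set) \<Rightarrow> ('k, nat \<Rightarrow> 'a set) module" where
  "assoc_graded A F =
     \<lparr>carrier = {a. (\<forall>n. a n \<in> (\<lambda>x. filt_below A F n +>\<^bsub>A\<^esub> x) ` F n) \<and>
                   finite {n. a n \<noteq> filt_below A F n}},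
      monoid.mult = (\<lambda>a b n. finprod (A A_Mod filt_below A F n)
                      (\<lambda>i. rcoset_mult A (filt_below A F n) (a i) (b (n - i))) {..n}),
      one = (\<lambda>n. if n = 0 then filt_below A F 0 +>\<^bsub>A\<^esub> \<one>\<^bsub>A\<^esub> else filt_below A F n),
      ring.zero = filt_below A F,
      add = (\<lambda>a b n. a n <+>\<^bsub>A\<^esub> b n),
      smult = (\<lambda>c a n. \<Union>x\<in>a n. filt_below A F n +>\<^bsub>A\<^esub> (c \<odot>\<^bsub>A\<^esub> x))\<rparr>"

definition assoc_graded_component ::
    "('k, 'a) module \<Rightarrow> (nat \<Rightarrow> 'a set) \<Rightarrow> nat \<Rightarrow> (nat \<Rightarrow> 'a set) set" where
  "assoc_graded_component A F n =
     {a \<in> carrier (assoc_graded A F). \<forall>m. m \<noteq> n \<longrightarrow> a m = filt_below A F m}"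


section \<open>Algebras generated by the group algebra and the vector space\<close>

datatype 'x free_monoid = Word (letters: "'x list")

instantiation free_monoid :: (type) monoid_add
begin

definition zero_free_monoid :: "'x free_monoid" where
  "zero_free_monoid = Word []"

definition plus_free_monoid :: "'x free_monoid \<Rightarrow> 'x free_monoid \<Rightarrow> 'x free_monoid" where
  "plus_free_monoid u w = Word (letters u @ letters w)"

instance
  by standard (simp_all add: zero_free_monoid_def plus_free_monoid_def)

end

text \<open>
  The free algebra on the disjoint union of the sets \<open>kG\<close> and \<open>V\<close>: finitely supported functions on
  words, with the convolution product of \<^type>\<open>poly_mapping\<close> coming from concatenation.
\<close>

type_synonym ('g, 'k, 'v) tens = "(('g \<Rightarrow>\<^sub>0 'k) + 'v) free_monoid \<Rightarrow>\<^sub>0 'k"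

definition free_algebra :: "('k, ('g, 'k::field, 'v) tens) module" where
  "free_algebra =
     \<lparr>carrier = UNIV, monoid.mult = (*), one = 1, ring.zero = 0, add = (+),
      smult = coeff_scale (*)\<rparr>"

definition in_kG :: "('g \<Rightarrow>\<^sub>0 'k) \<Rightarrow> ('g, 'k::field, 'v) tens" where
  "in_kG a = Poly_Mapping.single (Word [Inl a]) 1"

definition in_V :: "'v \<Rightarrow> ('g, 'k::field, 'v) tens" where
  "in_V v = Poly_Mapping.single (Word [Inr v]) 1"

definition in_G :: "'g \<Rightarrow> ('g, 'k::field, 'v) tens" where
  "in_G g = in_kG (Poly_Mapping.single g 1)"

definition in_kappa ::
    "('g \<Rightarrow>\<^sub>0 'k) \<times> ('g \<Rightarrow>\<^sub>0 'v) \<Rightarrow> ('g::finite, 'k::field, 'v::zero) tens" where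
  "in_kappa p = in_kG (fst p) + (\<Sum>g\<in>UNIV. in_V (Poly_Mapping.lookup (snd p) g) * in_G g)"

text \<open>
  The relations saying that \<open>kG\<close> maps to the quotient by a homomorphism of unital algebras and
  \<open>V\<close> by a linear map.
\<close>

definition generator_relations ::
    "('k::field \<Rightarrow> 'v::ab_group_add \<Rightarrow> 'v) \<Rightarrow> ('g::group_add, 'k, 'v) tens set" where
  "generator_relations sV =
     {in_kG (a + b) - in_kG a - in_kG b | a b. True} \<union>
     {in_kG (coeff_scale (*) c a) - coeff_scale (*) c (in_kG a) | c a. True} \<union>
     {in_kG (a * b) - in_kG a * in_kG b | a b. True} \<union>
     {in_kG 1 - 1} \<union>
     {in_V (v + w) - in_V v - in_V w | v w. True} \<union>
     {in_V (sV c v) - coeff_scale (*) c (in_V v) | c v. True}"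

definition relation_ideal ::
    "('k::field \<Rightarrow> 'v::ab_group_add \<Rightarrow> 'v) \<Rightarrow> ('g::group_add, 'k, 'v) tens set \<Rightarrow>
     ('g, 'k, 'v) tens set" where
  "relation_ideal sV R = genideal free_algebra (generator_relations sV \<union> R)"

definition presented_algebra ::
    "('k::field \<Rightarrow> 'v::ab_group_add \<Rightarrow> 'v) \<Rightarrow> ('g::group_add, 'k, 'v) tens set \<Rightarrow>
     ('k, ('g, 'k, 'v) tens set) module" where
  "presented_algebra sV R = quot_algebra free_algebra (relation_ideal sV R)"

definition V_degree :: "('a + 'v) free_monoid \<Rightarrow> nat" where
  "V_degree w = length (filter (\<lambda>x. \<not> isl x) (letters w))"

definition degree_le ::
    "('k::field \<Rightarrow> 'v::ab_group_add \<Rightarrow> 'v) \<Rightarrow> ('g::group_add, 'k, 'v) tens set \<Rightarrow>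
     nat \<Rightarrow> ('g, 'k, 'v) tens set set" where
  "degree_le sV R n =
     (\<lambda>p. relation_ideal sV R +>\<^bsub>free_algebra\<^esub> p) `
       {p. \<forall>w\<in>Poly_Mapping.keys p. V_degree w \<le> n}"

definition degree_eq ::
    "('k::field \<Rightarrow> 'v::ab_group_add \<Rightarrow> 'v) \<Rightarrow> ('g::group_add, 'k, 'v) tens set \<Rightarrow>
     nat \<Rightarrow> ('g, 'k, 'v) tens set set" where
  "degree_eq sV R n =
     (\<lambda>p. relation_ideal sV R +>\<^bsub>free_algebra\<^esub> p) `
       {p. \<forall>w\<in>Poly_Mapping.keys p. V_degree w = n}"


section \<open>The algebras \<open>S(V) \<rtimes> G\<close> and \<open>H\<^sub>\<lambda>\<^sub>,\<^sub>\<kappa>\<close>\<close>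

definition skew_relations ::
    "('g \<Rightarrow> 'v \<Rightarrow> 'v) \<Rightarrow> ('g::group_add, 'k::field, 'v::ab_group_add) tens set" where
  "skew_relations act =
     {in_V v * in_V w - in_V w * in_V v | v w. True} \<union>
     {in_G g * in_V v - in_V (act g v) * in_G g | g v. True}"

definition skew_group_algebra ::
    "('k::field \<Rightarrow> 'v::ab_group_add \<Rightarrow> 'v) \<Rightarrow> ('g::group_add \<Rightarrow> 'v \<Rightarrow> 'v) \<Rightarrow>
     ('k, ('g, 'k, 'v) tens set) module" where
  "skew_group_algebra sV act = presented_algebra sV (skew_relations act)"

definition skew_grading ::
    "('k::field \<Rightarrow> 'v::ab_group_add \<Rightarrow> 'v) \<Rightarrow> ('g::group_add \<Rightarrow> 'v \<Rightarrow> 'v) \<Rightarrow>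
     nat \<Rightarrow> ('g, 'k, 'v) tens set set" where
  "skew_grading sV act = degree_eq sV (skew_relations act)"

definition H_relations ::
    "('g \<Rightarrow> 'v \<Rightarrow> 'v) \<Rightarrow> (('g \<Rightarrow>\<^sub>0 'k) \<Rightarrow> 'v \<Rightarrow> ('g \<Rightarrow>\<^sub>0 'k)) \<Rightarrow>
     ('v \<Rightarrow> 'v \<Rightarrow> ('g \<Rightarrow>\<^sub>0 'k) \<times> ('g \<Rightarrow>\<^sub>0 'v)) \<Rightarrow>
     ('g::{group_add,finite}, 'k::field, 'v::ab_group_add) tens set" where
  "H_relations act lam \<kappa> =
     {in_G g * in_V v - in_V (act g v) * in_G g - in_kG (lam (Poly_Mapping.single g 1) v)
        | g v. True} \<union>
     {in_V v * in_V w - in_V w * in_V v - in_kappa (\<kappa> v w) | v w. True}"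

definition H_algebra ::
    "('k::field \<Rightarrow> 'v::ab_group_add \<Rightarrow> 'v) \<Rightarrow> ('g::{group_add,finite} \<Rightarrow> 'v \<Rightarrow> 'v) \<Rightarrow>
     (('g \<Rightarrow>\<^sub>0 'k) \<Rightarrow> 'v \<Rightarrow> ('g \<Rightarrow>\<^sub>0 'k)) \<Rightarrow> ('v \<Rightarrow> 'v \<Rightarrow> ('g \<Rightarrow>\<^sub>0 'k) \<times> ('g \<Rightarrow>\<^sub>0 'v)) \<Rightarrow>
     ('k, ('g, 'k, 'v) tens set) module" where
  "H_algebra sV act lam \<kappa> = presented_algebra sV (H_relations act lam \<kappa>)"

definition H_filtration ::
    "('k::field \<Rightarrow> 'v::ab_group_add \<Rightarrow> 'v) \<Rightarrow> ('g::{group_add,finite} \<Rightarrow> 'v \<Rightarrow> 'v) \<Rightarrow>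
     (('g \<Rightarrow>\<^sub>0 'k) \<Rightarrow> 'v \<Rightarrow> ('g \<Rightarrow>\<^sub>0 'k)) \<Rightarrow> ('v \<Rightarrow> 'v \<Rightarrow> ('g \<Rightarrow>\<^sub>0 'k) \<times> ('g \<Rightarrow>\<^sub>0 'v)) \<Rightarrow>
     nat \<Rightarrow> ('g, 'k, 'v) tens set set" where
  "H_filtration sV act lam \<kappa> = degree_le sV (H_relations act lam \<kappa>)"

definition PBW_deformation ::
    "('k::field \<Rightarrow> 'v::ab_group_add \<Rightarrow> 'v) \<Rightarrow> ('g::{group_add,finite} \<Rightarrow> 'v \<Rightarrow> 'v) \<Rightarrow>
     (('g \<Rightarrow>\<^sub>0 'k) \<Rightarrow> 'v \<Rightarrow> ('g \<Rightarrow>\<^sub>0 'k)) \<Rightarrow> ('v \<Rightarrow> 'v \<Rightarrow> ('g \<Rightarrow>\<^sub>0 'k) \<times> ('g \<Rightarrow>\<^sub>0 'v)) \<Rightarrow> bool" where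
  "PBW_deformation sV act lam \<kappa> \<longleftrightarrow>
     (let H = H_algebra sV act lam \<kappa>; F = H_filtration sV act lam \<kappa> in
      graded_isomorphic (assoc_graded H F) (assoc_graded_component H F)
        (skew_group_algebra sV act) (skew_grading sV act))"

end

theory Submission
  imports Defs
begin

text \<open>
  In \<open>H\<^sub>\<lambda>\<^sub>,\<^sub>\<kappa>\<close> the average \<open>v' = |G|\<inverse> \<Sum>\<^sub>g g (g\<inverse>\<cdot>v) g\<inverse>\<close> satisfies \<open>g v' = (g\<cdot>v)' g\<close>, and moving \<open>g\<close> past
  \<open>g\<inverse>\<cdot>v\<close> shows \<open>v' = v + \<gamma>(v)\<close> with \<open>\<gamma>(v) = |G|\<inverse> \<Sum>\<^sub>g \<lambda>(g, g\<inverse>\<cdot>v) g\<inverse>\<close> in \<open>kG\<close>. Any linear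
  \<open>\<gamma> : V \<rightarrow> kG\<close> gives a substitution \<open>v \<mapsto> v + \<gamma>(v)\<close> which transports the relations of one pair of
  parameters to those of another, is undone by \<open>v \<mapsto> v - \<gamma>(v)\<close>, and preserves the filtration. For
  the averaged \<open>\<gamma>\<close> the new \<open>\<lambda>\<close> vanishes as soon as \<open>\<lambda>\<close> satisfies the cocycle identity
  \<open>\<lambda>(gh, v) = g \<lambda>(h, v) + \<lambda>(g, h\<cdot>v) h\<close> in \<open>kG\<close>. That identity always holds in \<open>H\<^sub>\<lambda>\<^sub>,\<^sub>\<kappa>\<close>, and the PBW
  property makes \<open>kG \<rightarrow> H\<^sub>\<lambda>\<^sub>,\<^sub>\<kappa>\<close> injective.
\<close>

section \<open>Finitely supported functions\<close>

text \<open>Put c(g)(v) = \<lambda>(g, g\<inverse>\<cdot>v) g\<inverse>. The cocycle identity says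
  that c is a 1-cocycle of G with values in Hom(V, kG), where (g\<cdot>f)(v) = g
  f(g\<inverse>\<cdot>v) g\<inverse>. The average is the usual proof that such a cocycle is a
  coboundary when |G| is invertible in k: c(g) = \<gamma> - g\<cdot>\<gamma>. Once \<gamma> is
  fixed, the new \<kappa> is forced, being the commutator of v + \<gamma>(v) and w + \<gamma>(w)
  rewritten in the new variables. Two obstacles shape the rest. The PBW hypothesis provides some
  graded isomorphism, which need not be the canonical map, so injectivity of kG \<rightarrow> H has
  to come from a dimension count in degree 0. Moreover, elements of kG and V are letters of a free
  algebra, and the arithmetic of kG holds only modulo the relation ideal. Computations are therefore
  congruences, and maps between the quotients are built as substitutions in the free
  algebra.\<close>

lemma coeff_scale_times: "coeff_scale (*) c p = Poly_Mapping.single 0 c * p"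
  for p :: "'m::monoid_add \<Rightarrow>\<^sub>0 'k::field"
  by (simp add: coeff_scale_def mult_map_scale_conv_mult)

lemma sum_single_lookup:
  assumes "finite A" "Poly_Mapping.keys p \<subseteq> A"
  shows "(\<Sum>k\<in>A. Poly_Mapping.single k (Poly_Mapping.lookup p k)) = p"
proof (rule poly_mapping_eqI)
  fix j
  show "Poly_Mapping.lookup (\<Sum>k\<in>A. Poly_Mapping.single k (Poly_Mapping.lookup p k)) j =
    Poly_Mapping.lookup p j"
    using assms by (auto simp: lookup_sum lookup_single when_def in_keys_iff subset_iff)
qed

lemma poly_mapping_single_induct [case_names single add]:
  fixes p :: "'m \<Rightarrow>\<^sub>0 'k::comm_monoid_add"
  assumes "\<And>k c. P (Poly_Mapping.single k c)" "\<And>p q. P p \<Longrightarrow> P q \<Longrightarrow> P (p + q)"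
  shows "P p"
proof -
  have "P (\<Sum>k\<in>A. Poly_Mapping.single k (Poly_Mapping.lookup p k))" if "finite A" for A
    using that
  proof induction
    case empty
    show ?case using assms(1)[of undefined 0] by simp
  qed (simp add: assms)
  from this[OF finite_keys[of p]] show ?thesis
    by (simp add: sum_single_lookup)
qed

lemma single_0_commute: "p * Poly_Mapping.single 0 c = Poly_Mapping.single 0 c * p"
  for p :: "'m::monoid_add \<Rightarrow>\<^sub>0 'k::field"
  by (induction p rule: poly_mapping_single_induct)
    (simp_all add: mult_single algebra_simps)

lemma single_0_left_commute:
  "p * (Poly_Mapping.single 0 c * q) = Poly_Mapping.single 0 c * (p * q)"
  for p q :: "'m::monoid_add \<Rightarrow>\<^sub>0 'k::field"
  by (metis mult.assoc single_0_commute)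

lemma single_0_mult: "Poly_Mapping.single 0 (a * b) = Poly_Mapping.single 0 a * Poly_Mapping.single 0 b"
  for a b :: "'k::field"
  by (simp add: mult_single)

text \<open>Every word is a product of one-letter words, so statements compatible with sums and
  products need checking on scalars and letters only.\<close>

lemma free_algebra_induct [case_names scalar letter add mult]:
  fixes p :: "'x free_monoid \<Rightarrow>\<^sub>0 'k::field"
  assumes scalar: "\<And>c. P (Poly_Mapping.single 0 c)"
    and letter: "\<And>x. P (Poly_Mapping.single (Word [x]) 1)"
    and add: "\<And>p q. P p \<Longrightarrow> P q \<Longrightarrow> P (p + q)"
    and mult: "\<And>p q. P p \<Longrightarrow> P q \<Longrightarrow> P (p * q)"
  shows "P p"
proof (induction p rule: poly_mapping_single_induct)
  case (single w c)
  have "P (Poly_Mapping.single (Word xs) 1)" for xs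
  proof (induction xs)
    case Nil
    show ?case using scalar[of 1] by (simp add: zero_free_monoid_def)
  next
    case (Cons x xs)
    have "Poly_Mapping.single (Word (x # xs)) (1::'k) =
      Poly_Mapping.single (Word [x]) 1 * Poly_Mapping.single (Word xs) 1"
      by (simp add: mult_single plus_free_monoid_def)
    then show ?case using mult[OF letter Cons] by simp
  qed
  from mult[OF scalar this, of c "letters w"] show ?case
    by (simp add: mult_single)
qed (rule add)

section \<open>Evaluation of the free algebra\<close>

definition word_eval :: "('x \<Rightarrow> ('m::monoid_add \<Rightarrow>\<^sub>0 'k::field)) \<Rightarrow> 'x free_monoid \<Rightarrow> ('m \<Rightarrow>\<^sub>0 'k)" where
  "word_eval f w = prod_list (map f (letters w))"

text \<open>The homomorphism given by the universal property of the free algebra. The target is any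
  monoid algebra, which covers both substitutions of the free algebra into itself and the projection
  \<open>kill_V\<close> to kG.\<close>

definition free_eval ::
    "('x \<Rightarrow> ('m::monoid_add \<Rightarrow>\<^sub>0 'k::field)) \<Rightarrow> ('x free_monoid \<Rightarrow>\<^sub>0 'k) \<Rightarrow> ('m \<Rightarrow>\<^sub>0 'k)" where
  "free_eval f p = (\<Sum>w\<in>Poly_Mapping.keys p. Poly_Mapping.single 0 (Poly_Mapping.lookup p w) * word_eval f w)"

lemma free_eval_superset:
  assumes "finite A" "Poly_Mapping.keys p \<subseteq> A"
  shows "free_eval f p = (\<Sum>w\<in>A. Poly_Mapping.single 0 (Poly_Mapping.lookup p w) * word_eval f w)"
  unfolding free_eval_def
  by (rule sum.mono_neutral_left) (use assms in \<open>auto simp: in_keys_iff\<close>)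

lemma free_eval_add: "free_eval f (p + q) = free_eval f p + free_eval f q"
proof -
  let ?A = "Poly_Mapping.keys p \<union> Poly_Mapping.keys q"
  have "Poly_Mapping.keys (p + q) \<subseteq> ?A" by (rule keys_add)
  then show ?thesis
    by (subst (1 2 3) free_eval_superset[of ?A])
      (simp_all add: lookup_add single_add distrib_right sum.distrib)
qed

lemma free_eval_single: "free_eval f (Poly_Mapping.single w c) = Poly_Mapping.single 0 c * word_eval f w"
  by (subst free_eval_superset[of "{w}"]) auto

lemma free_eval_letter [simp]: "free_eval f (Poly_Mapping.single (Word [x]) 1) = f x"
  by (simp add: free_eval_single word_eval_def)

lemma free_eval_scalar [simp]: "free_eval f (Poly_Mapping.single 0 c) = Poly_Mapping.single 0 c"
  by (simp add: free_eval_single word_eval_def zero_free_monoid_def)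

lemma word_eval_plus: "word_eval f (u + w) = word_eval f u * word_eval f w"
  by (simp add: word_eval_def plus_free_monoid_def)

lemma free_eval_mult: "free_eval f (p * q) = free_eval f p * free_eval f q"
proof (induction p rule: poly_mapping_single_induct)
  case (single u c)
  show ?case
  proof (induction q rule: poly_mapping_single_induct)
    case (single w d)
    have "Poly_Mapping.single 0 (c * d) * (word_eval f u * word_eval f w) =
      Poly_Mapping.single 0 c * (Poly_Mapping.single 0 d * word_eval f u) * word_eval f w"
      by (simp add: single_0_mult mult.assoc)
    also have "\<dots> = Poly_Mapping.single 0 c * word_eval f u * (Poly_Mapping.single 0 d * word_eval f w)"
      by (simp only: mult.assoc single_0_left_commute[of "word_eval f u" d "word_eval f w"])
    finally show ?case
      by (simp add: mult_single free_eval_single word_eval_plus)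
  qed (simp add: distrib_left free_eval_add)
qed (simp add: distrib_right free_eval_add)

lemma free_eval_0 [simp]: "free_eval f 0 = 0"
  by (simp add: free_eval_def)

lemma free_eval_1 [simp]: "free_eval f 1 = 1"
  using free_eval_scalar[of f 1] by simp

lemma free_eval_uminus: "free_eval f (- p) = - free_eval f p"
  using free_eval_add[of f p "- p"] by (simp add: eq_neg_iff_add_eq_0 add.commute)

lemma free_eval_diff: "free_eval f (p - q) = free_eval f p - free_eval f q"
  using free_eval_add[of f p "- q"] by (simp add: free_eval_uminus)

lemma free_eval_sum: "free_eval f (sum g A) = (\<Sum>x\<in>A. free_eval f (g x))"
  by (induction A rule: infinite_finite_induct) (simp_all add: free_eval_add)

lemma free_eval_scale: "free_eval f (coeff_scale (*) c p) = coeff_scale (*) c (free_eval f p)"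
  by (simp add: coeff_scale_times free_eval_mult)

lemma free_eval_in_kG [simp]: "free_eval f (in_kG a) = f (Inl a)"
  by (simp add: in_kG_def)

lemma free_eval_in_V [simp]: "free_eval f (in_V v) = f (Inr v)"
  by (simp add: in_V_def)

lemma free_eval_in_G [simp]: "free_eval f (in_G g) = f (Inl (Poly_Mapping.single g 1))"
  by (simp add: in_G_def)

lemmas free_eval_hom = free_eval_add free_eval_mult free_eval_diff free_eval_sum free_eval_scale

section \<open>Ideals and quotients of the free algebra\<close>

lemma free_algebra_simps [simp]:
  "carrier free_algebra = UNIV" "monoid.mult free_algebra = (*)" "one free_algebra = 1"
  "ring.zero free_algebra = 0" "add free_algebra = (+)" "smult free_algebra = coeff_scale (*)"
  by (simp_all add: free_algebra_def)

lemma ring_free_algebra: "ring (free_algebra :: ('k, ('g, 'k::field, 'v) tens) module)"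
proof (rule ringI)
  show "abelian_group (free_algebra :: ('k, ('g, 'k, 'v) tens) module)"
  proof (rule abelian_groupI)
    fix x :: "('g, 'k, 'v) tens"
    show "\<exists>y\<in>carrier free_algebra. y \<oplus>\<^bsub>free_algebra\<^esub> x = \<zero>\<^bsub>free_algebra\<^esub>"
      by (simp, rule exI[of _ "- x"]) simp
  qed (simp_all add: ac_simps)
  show "Group.monoid (free_algebra :: ('k, ('g, 'k, 'v) tens) module)"
    by (rule monoidI) (simp_all add: mult.assoc)
qed (simp_all add: algebra_simps)

text \<open>Closure under negation comes for free, as multiplication by \<open>- 1\<close>.\<close>

lemma ideal_free_algebraI:
  assumes "0 \<in> J" "\<And>x y. x \<in> J \<Longrightarrow> y \<in> J \<Longrightarrow> x + y \<in> J"
    and "\<And>x y. x \<in> J \<Longrightarrow> y * x \<in> J" "\<And>x y. x \<in> J \<Longrightarrow> x * y \<in> J"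
  shows "ideal J (free_algebra :: ('k, ('g, 'k::field, 'v) tens) module)"
proof (rule idealI)
  interpret ring "free_algebra :: ('k, ('g, 'k, 'v) tens) module" by (rule ring_free_algebra)
  show "ring (free_algebra :: ('k, ('g, 'k, 'v) tens) module)" by (rule ring_free_algebra)
  show "subgroup J (add_monoid (free_algebra :: ('k, ('g, 'k, 'v) tens) module))"
  proof (rule add.subgroupI)
    fix a assume a: "a \<in> J"
    have "- a \<in> J" using assms(3)[OF a, of "- 1"] by simp
    moreover have "\<ominus>\<^bsub>free_algebra\<^esub> a = - a"
      by (rule minus_equality) simp_all
    ultimately show "\<ominus>\<^bsub>free_algebra\<^esub> a \<in> J" by simp
  qed (use assms in auto)
qed (use assms in simp_all)

locale free_ideal =
  fixes J :: "('g, 'k::field, 'v) tens set"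
  assumes ideal: "ideal J (free_algebra :: ('k, ('g, 'k, 'v) tens) module)"
begin

sublocale ideal J "free_algebra :: ('k, ('g, 'k, 'v) tens) module"
  by (rule ideal)

lemma mem_0: "0 \<in> J"
  using additive_subgroup.zero_closed[OF is_additive_subgroup] by simp

lemma mem_add: "x \<in> J \<Longrightarrow> y \<in> J \<Longrightarrow> x + y \<in> J"
  using additive_subgroup.a_closed[OF is_additive_subgroup, of x y] by simp

lemma mem_lmult: "x \<in> J \<Longrightarrow> y * x \<in> J"
  using I_l_closed by simp

lemma mem_rmult: "x \<in> J \<Longrightarrow> x * y \<in> J"
  using I_r_closed by simp

lemma mem_uminus: "x \<in> J \<Longrightarrow> - x \<in> J"
  using mem_lmult[of x "- 1"] by simp

lemma mem_diff: "x \<in> J \<Longrightarrow> y \<in> J \<Longrightarrow> x - y \<in> J"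
  using mem_add[of x "- y"] mem_uminus by simp

lemma mem_scale: "x \<in> J \<Longrightarrow> coeff_scale (*) c x \<in> J"
  by (simp add: coeff_scale_times mem_lmult)

lemma mem_sum: "(\<And>x. x \<in> A \<Longrightarrow> f x \<in> J) \<Longrightarrow> sum f A \<in> J"
  by (induction A rule: infinite_finite_induct) (simp_all add: mem_0 mem_add)

definition cls :: "('g, 'k, 'v) tens \<Rightarrow> ('g, 'k, 'v) tens set" where
  "cls p = J +>\<^bsub>free_algebra\<^esub> p"

lemma cls_eq_iff: "cls p = cls q \<longleftrightarrow> p - q \<in> J"
proof -
  have "(q \<in> cls p) = (q - p \<in> J)" for p q
  proof
    assume "q \<in> cls p"
    then show "q - p \<in> J" by (auto simp: cls_def a_r_coset_def r_coset_def)
  next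
    assume "q - p \<in> J"
    then have "(q - p) + p \<in> cls p" unfolding cls_def a_r_coset_def r_coset_def by force
    then show "q \<in> cls p" by simp
  qed
  note * = this
  show ?thesis
  proof
    assume "cls p = cls q"
    moreover have "p \<in> cls p" using *[of p p] mem_0 by simp
    ultimately show "p - q \<in> J" using *[of p q] by simp
  next
    assume pq: "p - q \<in> J"
    have "x - p \<in> J \<longleftrightarrow> x - q \<in> J" for x
      using mem_add[of "x - p" "p - q"] mem_diff[of "x - q" "p - q"] pq by auto
    then show "cls p = cls q" using * by blast
  qed
qed

lemma mem_cls: "q \<in> cls p \<longleftrightarrow> cls q = cls p"
proof
  assume "q \<in> cls p"
  then have "q - p \<in> J" by (auto simp: cls_def a_r_coset_def r_coset_def)
  then show "cls q = cls p" by (simp add: cls_eq_iff)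
next
  have "0 + q \<in> cls q" unfolding cls_def a_r_coset_def r_coset_def using mem_0 by force
  moreover assume "cls q = cls p"
  ultimately show "q \<in> cls p" by simp
qed

abbreviation Q :: "('k, ('g, 'k, 'v) tens set) module" where
  "Q \<equiv> quot_algebra free_algebra J"

lemma Q_parts: "carrier Q = carrier (free_algebra Quot J)" "monoid.mult Q = monoid.mult (free_algebra Quot J)"
  "one Q = one (free_algebra Quot J)"
  "add Q = add (free_algebra Quot J)" "ring.zero Q = ring.zero (free_algebra Quot J)"
  "smult Q = (\<lambda>c C. \<Union>x\<in>C. J +>\<^bsub>free_algebra\<^esub> (c \<odot>\<^bsub>free_algebra\<^esub> x))"
  by (simp_all add: quot_algebra_def ring.defs module.defs)

lemma Q_carrier: "carrier Q = range cls"
  unfolding Q_parts by (auto simp: FactRing_def A_RCOSETS_def RCOSETS_def a_r_coset_def cls_def)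

lemma cls_carrier: "cls p \<in> carrier Q"
  by (simp add: Q_carrier)

lemma Q_mult: "cls p \<otimes>\<^bsub>Q\<^esub> cls q = cls (p * q)"
  using rcoset_mult_add[of p q] by (simp add: Q_parts FactRing_simps cls_def)

lemma Q_add: "cls p \<oplus>\<^bsub>Q\<^esub> cls q = cls (p + q)"
  using a_rcos_sum[of p q] by (simp add: Q_parts FactRing_simps cls_def)

lemma Q_one: "\<one>\<^bsub>Q\<^esub> = cls 1"
  by (simp add: Q_parts FactRing_simps cls_def)

lemma Q_zero: "\<zero>\<^bsub>Q\<^esub> = cls 0"
  by (auto simp add: Q_parts FactRing_simps cls_def a_r_coset_def r_coset_def)

text \<open>The union over representatives that defines the scalar action is a union of one and the
  same coset, since the ideal absorbs scalars.\<close>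

lemma Q_smult: "c \<odot>\<^bsub>Q\<^esub> cls p = cls (coeff_scale (*) c p)"
proof -
  have "cls (coeff_scale (*) c x) = cls (coeff_scale (*) c p)" if "x \<in> cls p" for x
  proof -
    have "x - p \<in> J" using that by (simp add: mem_cls cls_eq_iff)
    then have "coeff_scale (*) c (x - p) \<in> J" by (rule mem_scale)
    then show ?thesis by (simp add: cls_eq_iff coeff_scale_times right_diff_distrib)
  qed
  then have "(\<Union>x\<in>cls p. cls (coeff_scale (*) c x)) = (\<Union>x\<in>cls p. cls (coeff_scale (*) c p))"
    by (intro SUP_cong) simp_all
  also have "p \<in> cls p" by (simp add: mem_cls)
  then have "(\<Union>x\<in>cls p. cls (coeff_scale (*) c p)) = cls (coeff_scale (*) c p)"
    by (intro UN_constant_eq) auto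
  finally show ?thesis by (simp add: Q_parts cls_def)
qed

lemma Q_ring: "ring Q"
proof (rule ringI)
  show "abelian_group Q"
  proof (rule abelian_groupI)
    fix x assume "x \<in> carrier Q"
    then obtain p where "x = cls p" by (auto simp: Q_carrier)
    then have "cls (- p) \<oplus>\<^bsub>Q\<^esub> x = \<zero>\<^bsub>Q\<^esub>" by (simp add: Q_add Q_zero)
    then show "\<exists>y\<in>carrier Q. y \<oplus>\<^bsub>Q\<^esub> x = \<zero>\<^bsub>Q\<^esub>"
      by (rule bexI[OF _ cls_carrier])
  qed (auto simp: Q_carrier Q_add Q_zero add_ac)
  show "Group.monoid Q"
    by (rule monoidI) (auto simp: Q_carrier Q_mult Q_one mult.assoc)
qed (auto simp: Q_carrier Q_mult Q_add distrib_left distrib_right)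

end

section \<open>Associated graded algebras\<close>

text \<open>Products in the associated graded algebra are \<open>finprod\<close>s of cosets; this
  carries an induced homomorphism through them.\<close>

lemma finprod_hom_image:
  assumes "comm_group G" "comm_group G'" "h \<in> hom G G'" "f \<in> A \<rightarrow> carrier G"
  shows "h (finprod G f A) = finprod G' (\<lambda>x. h (f x)) A"
proof -
  interpret G: comm_group G by fact
  interpret G': comm_group G' by fact
  have one: "h \<one>\<^bsub>G\<^esub> = \<one>\<^bsub>G'\<^esub>"
    using hom_one[OF assms(3)] G.is_group G'.is_group by blast
  show ?thesis
    using assms(4)
  proof (induction A rule: infinite_finite_induct)
    case (insert x A)
    then show ?case
      using hom_in_carrier[OF assms(3)] by (simp add: hom_mult[OF assms(3)] Pi_iff)
  qed (simp_all add: one)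
qed

text \<open>The axiom \<open>smult_zero\<close> makes the layer below degree 0, which is zero,
  stable under scalars.\<close>

locale filtered_algebra = ring A for A :: "('k, 'a) module" (structure) +
  fixes F :: "nat \<Rightarrow> 'a set"
  assumes F_additive: "additive_subgroup (F n) A"
    and F_mono: "F n \<subseteq> F (Suc n)"
    and F_mult: "x \<in> F m \<Longrightarrow> y \<in> F n \<Longrightarrow> x \<otimes>\<^bsub>A\<^esub> y \<in> F (m + n)"
    and smult_closed: "x \<in> carrier A \<Longrightarrow> c \<odot>\<^bsub>A\<^esub> x \<in> carrier A"
    and smult_zero: "c \<odot>\<^bsub>A\<^esub> \<zero>\<^bsub>A\<^esub> = \<zero>\<^bsub>A\<^esub>"
    and F_smult: "x \<in> F n \<Longrightarrow> c \<odot>\<^bsub>A\<^esub> x \<in> F n"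
begin

lemma F_carrier: "x \<in> F n \<Longrightarrow> x \<in> carrier A"
  by (rule additive_subgroup.a_Hcarr[OF F_additive])

abbreviation "Fb \<equiv> filt_below A F"

lemma Fb_additive: "additive_subgroup (Fb n) A"
  using F_additive ideal.axioms(1)[OF zeroideal] by (simp add: filt_below_def split: nat.split)

lemma Fb_carrier: "x \<in> Fb n \<Longrightarrow> x \<in> carrier A"
  by (rule additive_subgroup.a_Hcarr[OF Fb_additive])

lemma Fb_subset: "Fb n \<subseteq> carrier A"
  using Fb_carrier by blast

lemma Fb_le: "Fb n \<subseteq> F n"
  using F_mono additive_subgroup.zero_closed[OF F_additive] by (auto simp: filt_below_def split: nat.split)

lemma Fb_mult_left: "x \<in> Fb m \<Longrightarrow> y \<in> F n \<Longrightarrow> x \<otimes> y \<in> Fb (m + n)"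
  using F_mult F_carrier additive_subgroup.zero_closed[OF F_additive]
  by (cases m; cases n) (force simp: filt_below_def)+

lemma Fb_mult_right: "x \<in> F m \<Longrightarrow> y \<in> Fb n \<Longrightarrow> x \<otimes> y \<in> Fb (m + n)"
  using F_mult F_carrier additive_subgroup.zero_closed[OF F_additive]
  by (cases m; cases n) (force simp: filt_below_def)+

sublocale Fb: abelian_subgroup "Fb n" A for n
  by (rule abelian_subgroupI3[OF Fb_additive]) (rule abelian_group_axioms)

lemma comm_group_Mod: "comm_group (A A_Mod Fb n)"
  by (rule Fb.a_factorgroup_is_comm_group)

lemma carrier_Mod: "U \<in> carrier (A A_Mod Fb n) \<longleftrightarrow> (\<exists>x\<in>carrier A. U = Fb n +> x)"
  by (auto simp: A_FactGroup_def FactGroup_def RCOSETS_def a_r_coset_def)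

lemma coset_subset: "x \<in> carrier A \<Longrightarrow> Fb n +> x \<subseteq> carrier A"
  by (rule a_r_coset_subset_G[OF Fb_subset])

lemma coset_eqI:
  assumes "x \<in> carrier A" "y \<in> carrier A" "x \<ominus> y \<in> Fb n"
  shows "Fb n +> x = Fb n +> y"
proof -
  have "(x \<ominus> y) \<oplus> y \<in> Fb n +> y" using assms by (auto simp: a_r_coset_def')
  moreover have "(x \<ominus> y) \<oplus> y = x" using assms by algebra
  ultimately have "x \<in> Fb n +> y" by simp
  then show ?thesis using assms Fb.a_repr_independence'[of x n y] by simp
qed

text \<open>Well-definedness of the product on the associated graded algebra: changing the factors
  by lower terms i and j changes the product by i(j + y) + xj, which lies one layer down.\<close>

lemma rcoset_mult_coset:
  assumes "x \<in> F m" "y \<in> F n"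
  shows "rcoset_mult A (Fb (m + n)) (Fb m +> x) (Fb n +> y) = Fb (m + n) +> (x \<otimes> y)"
proof -
  have "Fb (m + n) +> (a \<otimes> b) = Fb (m + n) +> (x \<otimes> y)" if ab: "a \<in> Fb m +> x" "b \<in> Fb n +> y" for a b
  proof (rule coset_eqI)
    obtain i j where i: "i \<in> Fb m" "a = i \<oplus> x" and j: "j \<in> Fb n" "b = j \<oplus> y"
      using ab by (auto simp: a_r_coset_def')
    have car: "i \<in> carrier A" "j \<in> carrier A" "x \<in> carrier A" "y \<in> carrier A"
      using i j Fb_carrier F_carrier assms by auto
    then show "a \<otimes> b \<in> carrier A" "x \<otimes> y \<in> carrier A" using i j by auto
    have "a \<otimes> b \<ominus> x \<otimes> y = i \<otimes> (j \<oplus> y) \<oplus> x \<otimes> j"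
      unfolding i(2) j(2) using car by algebra
    moreover have "j \<oplus> y \<in> F n"
      using j(1) Fb_le assms additive_subgroup.a_closed[OF F_additive] by blast
    ultimately show "a \<otimes> b \<ominus> x \<otimes> y \<in> Fb (m + n)"
      using Fb_mult_left[OF i(1)] Fb_mult_right[OF assms(1) j(1)]
        additive_subgroup.a_closed[OF Fb_additive] by simp
  qed
  moreover have "Fb m +> x \<noteq> {}" "Fb n +> y \<noteq> {}"
    using Fb.a_rcos_self assms F_carrier by blast+
  ultimately show ?thesis
    unfolding rcoset_mult_def by (simp cong: SUP_cong)
qed

lemma graded_carrier:
  "a \<in> carrier (assoc_graded A F) \<longleftrightarrow> (\<forall>n. \<exists>x\<in>F n. a n = Fb n +> x) \<and> finite {n. a n \<noteq> Fb n}"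
  by (auto simp: assoc_graded_def)

lemma graded_subset: "a \<in> carrier (assoc_graded A F) \<Longrightarrow> a n \<subseteq> carrier A"
  using coset_subset F_carrier by (metis graded_carrier)

end

section \<open>Functoriality of the associated graded algebra under filtered isomorphisms\<close>

locale filtered_algebra_iso = A: filtered_algebra A F + B: filtered_algebra B E
  for A :: "('k, 'a) module" and F and B :: "('k, 'b) module" and E +
  fixes \<phi>
  assumes iso: "\<phi> \<in> algebra_iso A B" and image_F: "\<phi> ` F n = E n"
begin

lemma hom: "\<phi> \<in> ring_hom A B" and bij: "bij_betw \<phi> (carrier A) (carrier B)"
  and smult: "x \<in> carrier A \<Longrightarrow> \<phi> (c \<odot>\<^bsub>A\<^esub> x) = c \<odot>\<^bsub>B\<^esub> \<phi> x"
  using iso by (auto simp: algebra_iso_def ring_iso_def)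

lemma hom_zero: "\<phi> \<zero>\<^bsub>A\<^esub> = \<zero>\<^bsub>B\<^esub>"
  by (rule ring_hom_zero[OF hom A.ring_axioms B.ring_axioms])

lemmas inj = bij_betw_imp_inj_on[OF bij]

lemma image_Fb: "\<phi> ` filt_below A F n = filt_below B E n"
  by (simp add: filt_below_def hom_zero image_F split: nat.split)

lemma image_coset:
  assumes "S \<subseteq> carrier A" "x \<in> carrier A"
  shows "\<phi> ` (S +>\<^bsub>A\<^esub> x) = \<phi> ` S +>\<^bsub>B\<^esub> \<phi> x"
proof -
  have "\<phi> (h \<oplus>\<^bsub>A\<^esub> x) = \<phi> h \<oplus>\<^bsub>B\<^esub> \<phi> x" if "h \<in> S" for h
    using that assms ring_hom_add[OF hom] by blast
  then show ?thesis
    by (simp add: a_r_coset_def' image_UN)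
qed

lemma image_Fb_coset:
  "x \<in> carrier A \<Longrightarrow> \<phi> ` (filt_below A F n +>\<^bsub>A\<^esub> x) = filt_below B E n +>\<^bsub>B\<^esub> \<phi> x"
  using image_coset[OF A.Fb_subset] image_Fb by metis

lemma image_set_add:
  assumes "S \<subseteq> carrier A" "T \<subseteq> carrier A"
  shows "\<phi> ` (S <+>\<^bsub>A\<^esub> T) = \<phi> ` S <+>\<^bsub>B\<^esub> \<phi> ` T"
proof -
  have "\<phi> (s \<oplus>\<^bsub>A\<^esub> t) = \<phi> s \<oplus>\<^bsub>B\<^esub> \<phi> t" if "s \<in> S" "t \<in> T" for s t
    using that assms ring_hom_add[OF hom] by blast
  then show ?thesis
    by (simp add: set_add_def' image_UN)
qed

lemma image_rcoset_mult:
  assumes "S \<subseteq> carrier A" "T \<subseteq> carrier A"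
  shows "\<phi> ` rcoset_mult A (filt_below A F n) S T = rcoset_mult B (filt_below B E n) (\<phi> ` S) (\<phi> ` T)"
proof -
  have "\<phi> ` (filt_below A F n +>\<^bsub>A\<^esub> (s \<otimes>\<^bsub>A\<^esub> t)) = filt_below B E n +>\<^bsub>B\<^esub> (\<phi> s \<otimes>\<^bsub>B\<^esub> \<phi> t)"
    if "s \<in> S" "t \<in> T" for s t
  proof -
    have "s \<in> carrier A" "t \<in> carrier A" using that assms by auto
    then show ?thesis using image_Fb_coset ring_hom_mult[OF hom] by simp
  qed
  then show ?thesis
    by (simp add: rcoset_mult_def image_UN)
qed

lemma image_hom_Mod: "image \<phi> \<in> hom (A A_Mod filt_below A F n) (B A_Mod filt_below B E n)"
proof (rule homI)
  fix U W
  assume "U \<in> carrier (A A_Mod filt_below A F n)" "W \<in> carrier (A A_Mod filt_below A F n)"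
  then obtain x y where x: "x \<in> carrier A" "U = filt_below A F n +>\<^bsub>A\<^esub> x"
    and y: "y \<in> carrier A" "W = filt_below A F n +>\<^bsub>A\<^esub> y"
    by (auto simp: A.carrier_Mod)
  show "\<phi> ` U \<in> carrier (B A_Mod filt_below B E n)"
    using x ring_hom_closed[OF hom x(1)]
    by (auto simp: image_Fb_coset B.carrier_Mod)
  show "\<phi> ` (U \<otimes>\<^bsub>A A_Mod filt_below A F n\<^esub> W) = \<phi> ` U \<otimes>\<^bsub>B A_Mod filt_below B E n\<^esub> \<phi> ` W"
    using x y A.coset_subset by (simp add: image_set_add)
qed

text \<open>The induced map gr(\<phi>). Cosets are sets, so the image of a coset is already the
  coset of the image and no representatives are chosen.\<close>

definition gmap :: "(nat \<Rightarrow> 'a set) \<Rightarrow> nat \<Rightarrow> 'b set" where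
  "gmap a = (\<lambda>n. \<phi> ` a n)"

text \<open>Injectivity of \<phi> keeps nonzero entries nonzero. This preserves finite support and
  homogeneous components in both directions.\<close>

lemma gmap_zero_iff: "a \<in> carrier (assoc_graded A F) \<Longrightarrow> \<phi> ` a n = filt_below B E n \<longleftrightarrow> a n = filt_below A F n"
  using inj_on_image_eq_iff[OF inj, of "a n" "filt_below A F n"] image_Fb A.graded_subset A.Fb_subset by metis

lemma gmap_closed:
  assumes "a \<in> carrier (assoc_graded A F)"
  shows "gmap a \<in> carrier (assoc_graded B E)"
proof -
  have "\<exists>y\<in>E n. gmap a n = filt_below B E n +>\<^bsub>B\<^esub> y" for n
  proof -
    obtain x where "x \<in> F n" "a n = filt_below A F n +>\<^bsub>A\<^esub> x"
      using assms by (auto simp: A.graded_carrier)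
    then show ?thesis
      using image_F[of n] by (auto simp: gmap_def image_Fb_coset A.F_carrier)
  qed
  then show ?thesis
    using assms gmap_zero_iff[OF assms] by (simp add: B.graded_carrier A.graded_carrier gmap_def)
qed

lemma gmap_bij: "bij_betw gmap (carrier (assoc_graded A F)) (carrier (assoc_graded B E))"
proof (rule bij_betw_imageI)
  show "inj_on gmap (carrier (assoc_graded A F))"
  proof (rule inj_onI)
    fix a b assume ab: "a \<in> carrier (assoc_graded A F)" "b \<in> carrier (assoc_graded A F)" "gmap a = gmap b"
    then have "\<phi> ` a n = \<phi> ` b n" for n by (simp add: gmap_def fun_eq_iff)
    then have "a n = b n" for n
      using inj_on_image_eq_iff[OF inj A.graded_subset[OF ab(1)] A.graded_subset[OF ab(2)]] by blast
    then show "a = b" by (rule ext)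
  qed
  show "gmap ` carrier (assoc_graded A F) = carrier (assoc_graded B E)"
  proof (intro equalityI subsetI)
    fix b assume b: "b \<in> carrier (assoc_graded B E)"
    \<comment> \<open>Surjectivity is obtained degree by degree: a representative in
      \<open>E n\<close> lifts to \<open>F n\<close> because \<phi> maps each layer onto the
      corresponding layer.\<close>
    have "\<forall>n. \<exists>y\<in>\<phi> ` F n. b n = filt_below B E n +>\<^bsub>B\<^esub> y"
      using b by (simp add: B.graded_carrier image_F)
    then have "\<forall>n. \<exists>x\<in>F n. b n = filt_below B E n +>\<^bsub>B\<^esub> \<phi> x"
      by simp
    then obtain x where x: "\<And>n. x n \<in> F n" "\<And>n. b n = filt_below B E n +>\<^bsub>B\<^esub> \<phi> (x n)"
      by metis
    define a where "a = (\<lambda>n. filt_below A F n +>\<^bsub>A\<^esub> x n)"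
    have b_eq: "b = gmap a"
      by (rule ext) (simp add: gmap_def a_def x image_Fb_coset A.F_carrier[OF x(1)])
    have "{n. a n \<noteq> filt_below A F n} \<subseteq> {n. b n \<noteq> filt_below B E n}"
    proof (intro Collect_mono impI notI)
      fix n assume "a n \<noteq> filt_below A F n" "b n = filt_below B E n"
      moreover have "a n \<subseteq> carrier A"
        by (simp add: a_def A.coset_subset[OF A.F_carrier[OF x(1)]])
      ultimately show False
        using inj_on_image_eq_iff[OF inj _ A.Fb_subset, of "a n" n] image_Fb[of n]
        by (simp add: b_eq gmap_def)
    qed
    moreover have "finite {n. b n \<noteq> filt_below B E n}"
      using b by (simp add: B.graded_carrier)
    ultimately have "a \<in> carrier (assoc_graded A F)"
      using x(1) finite_subset by (auto simp: A.graded_carrier a_def)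
    then show "b \<in> gmap ` carrier (assoc_graded A F)" using b_eq by blast
  qed (auto simp: gmap_closed)
qed

lemma gmap_mult:
  assumes a: "a \<in> carrier (assoc_graded A F)" and b: "b \<in> carrier (assoc_graded A F)"
  shows "gmap (a \<otimes>\<^bsub>assoc_graded A F\<^esub> b) = gmap a \<otimes>\<^bsub>assoc_graded B E\<^esub> gmap b"
proof (rule ext)
  fix n
  let ?f = "\<lambda>i. rcoset_mult A (filt_below A F n) (a i) (b (n - i))"
  \<comment> \<open>Each summand must be a genuine coset before a homomorphism can pass through
    \<open>finprod\<close>. The degrees i and n - i add up to n because i \<le> n.\<close>
  have f: "?f \<in> {..n} \<rightarrow> carrier (A A_Mod filt_below A F n)"
  proof
    fix i assume i: "i \<in> {..n}"
    obtain x y where xy: "x \<in> F i" "a i = filt_below A F i +>\<^bsub>A\<^esub> x"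
        "y \<in> F (n - i)" "b (n - i) = filt_below A F (n - i) +>\<^bsub>A\<^esub> y"
      using a b by (metis A.graded_carrier)
    then have "?f i = filt_below A F n +>\<^bsub>A\<^esub> (x \<otimes>\<^bsub>A\<^esub> y)"
      using A.rcoset_mult_coset[OF xy(1,3)] i by simp
    then show "?f i \<in> carrier (A A_Mod filt_below A F n)"
      using xy A.F_carrier by (auto simp: A.carrier_Mod)
  qed
  have "gmap (a \<otimes>\<^bsub>assoc_graded A F\<^esub> b) n = \<phi> ` finprod (A A_Mod filt_below A F n) ?f {..n}"
    by (simp add: gmap_def assoc_graded_def)
  also have "\<dots> = finprod (B A_Mod filt_below B E n) (\<lambda>i. \<phi> ` ?f i) {..n}"
    by (rule finprod_hom_image[OF A.comm_group_Mod B.comm_group_Mod image_hom_Mod f])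
  also have "(\<lambda>i. \<phi> ` ?f i) = (\<lambda>i. rcoset_mult B (filt_below B E n) (gmap a i) (gmap b (n - i)))"
    using a b by (auto simp: gmap_def image_rcoset_mult A.graded_subset fun_eq_iff)
  finally show "gmap (a \<otimes>\<^bsub>assoc_graded A F\<^esub> b) n = (gmap a \<otimes>\<^bsub>assoc_graded B E\<^esub> gmap b) n"
    by (simp add: assoc_graded_def)
qed

lemma gmap_iso: "gmap \<in> algebra_iso (assoc_graded A F) (assoc_graded B E)"
proof -
  have "gmap \<in> ring_iso (assoc_graded A F) (assoc_graded B E)"
  proof (rule ring_iso_memI)
    fix a b assume ab: "a \<in> carrier (assoc_graded A F)" "b \<in> carrier (assoc_graded A F)"
    show "gmap (a \<oplus>\<^bsub>assoc_graded A F\<^esub> b) = gmap a \<oplus>\<^bsub>assoc_graded B E\<^esub> gmap b"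
      using ab A.graded_subset by (simp add: assoc_graded_def gmap_def image_set_add fun_eq_iff)
  next
    show "gmap \<one>\<^bsub>assoc_graded A F\<^esub> = \<one>\<^bsub>assoc_graded B E\<^esub>"
      by (rule ext) (simp add: assoc_graded_def gmap_def image_Fb_coset image_Fb ring_hom_one[OF hom])
  qed (auto simp: gmap_closed gmap_mult gmap_bij)
  moreover have "gmap (c \<odot>\<^bsub>assoc_graded A F\<^esub> a) = c \<odot>\<^bsub>assoc_graded B E\<^esub> gmap a"
    if a: "a \<in> carrier (assoc_graded A F)" for c a
  proof (rule ext)
    fix n
    have "\<phi> ` (filt_below A F n +>\<^bsub>A\<^esub> (c \<odot>\<^bsub>A\<^esub> x)) = filt_below B E n +>\<^bsub>B\<^esub> (c \<odot>\<^bsub>B\<^esub> \<phi> x)"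
      if "x \<in> a n" for x
    proof -
      have "x \<in> carrier A" using that A.graded_subset[OF a] by blast
      then show ?thesis by (simp add: image_Fb_coset A.smult_closed smult)
    qed
    then show "gmap (c \<odot>\<^bsub>assoc_graded A F\<^esub> a) n = (c \<odot>\<^bsub>assoc_graded B E\<^esub> gmap a) n"
      by (simp add: assoc_graded_def gmap_def image_UN)
  qed
  ultimately show ?thesis by (simp add: algebra_iso_def)
qed

text \<open>Carries the PBW property from one pair of parameters to another. Components are
  respected because gr(\<phi>) neither creates nor kills entries.\<close>

lemma assoc_graded_isomorphic:
  "graded_isomorphic (assoc_graded A F) (assoc_graded_component A F)
     (assoc_graded B E) (assoc_graded_component B E)"
  unfolding graded_isomorphic_def
proof (intro bexI allI)
  fix n
  have surj: "gmap ` carrier (assoc_graded A F) = carrier (assoc_graded B E)"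
    using gmap_bij by (rule bij_betw_imp_surj_on)
  have "gmap a \<in> assoc_graded_component B E n \<longleftrightarrow> a \<in> assoc_graded_component A F n"
    if "a \<in> carrier (assoc_graded A F)" for a
    using gmap_zero_iff[OF that] gmap_closed[OF that] that
    by (simp add: assoc_graded_component_def gmap_def)
  moreover have "assoc_graded_component A F n \<subseteq> carrier (assoc_graded A F)"
    "assoc_graded_component B E n \<subseteq> gmap ` carrier (assoc_graded A F)"
    by (auto simp: assoc_graded_component_def surj)
  ultimately show "gmap ` assoc_graded_component A F n = assoc_graded_component B E n"
    by blast
qed (rule gmap_iso)

end

lemma algebra_iso_trans:
  assumes "f \<in> algebra_iso A B" "g \<in> algebra_iso B C"
  shows "g \<circ> f \<in> algebra_iso A C"
  using assms ring_iso_set_trans[of f A B g C] ring_hom_closed[of f A B]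
  by (auto simp: algebra_iso_def ring_iso_def)

lemma graded_isomorphic_trans:
  assumes "graded_isomorphic A D B E" "graded_isomorphic B E C H"
  shows "graded_isomorphic A D C H"
proof -
  obtain f g where f: "f \<in> algebra_iso A B" "\<And>n. f ` D n = E n"
    and g: "g \<in> algebra_iso B C" "\<And>n. g ` E n = H n"
    using assms unfolding graded_isomorphic_def by blast
  have "(g \<circ> f) ` D n = H n" for n
    by (simp only: image_comp[symmetric] f(2) g(2))
  then show ?thesis
    using algebra_iso_trans[OF f(1) g(1)] unfolding graded_isomorphic_def by blast
qed

section \<open>Deformation relations\<close>

context free_ideal begin

text \<open>Equality in the quotient, expressed on representatives, so that calculations become
  transitive chains without cosets.\<close>

definition cong :: "('g, 'k, 'v) tens \<Rightarrow> ('g, 'k, 'v) tens \<Rightarrow> bool" (infix "\<asymp>" 50) where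
  "x \<asymp> y \<longleftrightarrow> x - y \<in> J"

lemma cong_refl [simp, intro]: "x \<asymp> x"
  by (simp add: cong_def mem_0)

lemma cong_sym: "x \<asymp> y \<Longrightarrow> y \<asymp> x"
  using mem_uminus[of "x - y"] by (simp add: cong_def)

lemma cong_trans [trans]: "x \<asymp> y \<Longrightarrow> y \<asymp> z \<Longrightarrow> x \<asymp> z"
  using mem_add[of "x - y" "y - z"] by (simp add: cong_def)

lemma cong_add: "x \<asymp> y \<Longrightarrow> x' \<asymp> y' \<Longrightarrow> x + x' \<asymp> y + y'"
  using mem_add[of "x - y" "x' - y'"] by (simp add: cong_def algebra_simps)

lemma cong_diff: "x \<asymp> y \<Longrightarrow> x' \<asymp> y' \<Longrightarrow> x - x' \<asymp> y - y'"
  using mem_diff[of "x - y" "x' - y'"] by (simp add: cong_def algebra_simps)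

lemma cong_mult:
  assumes "x \<asymp> y" "x' \<asymp> y'" shows "x * x' \<asymp> y * y'"
proof -
  have "(x - y) * x' + y * (x' - y') \<in> J"
    using assms by (intro mem_add mem_lmult mem_rmult) (simp_all add: cong_def)
  then show ?thesis by (simp add: cong_def algebra_simps)
qed

lemma cong_sum: "(\<And>x. x \<in> A \<Longrightarrow> f x \<asymp> h x) \<Longrightarrow> sum f A \<asymp> sum h A"
  using mem_sum[of A "\<lambda>x. f x - h x"] by (simp add: cong_def sum_subtractf)

lemma cong_scale: "x \<asymp> y \<Longrightarrow> coeff_scale (*) c x \<asymp> coeff_scale (*) c y"
  unfolding coeff_scale_times by (intro cong_mult cong_refl)

lemma mem_iff_cong_0: "x \<in> J \<longleftrightarrow> x \<asymp> 0"
  by (simp add: cong_def)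

end

lemma relation_ideal_free_ideal: "free_ideal (relation_ideal sV R)"
  unfolding relation_ideal_def by (rule free_ideal.intro, rule ring.genideal_ideal[OF ring_free_algebra]) simp

lemma relation_ideal_contains: "generator_relations sV \<union> R \<subseteq> relation_ideal sV R"
  unfolding relation_ideal_def by (rule ring.genideal_self[OF ring_free_algebra]) simp

text \<open>Preimages of two-sided ideals are two-sided ideals, so checking generators suffices. The
  closure properties of \<open>J\<close> are spelled out because \<open>J\<close> may live in kG
  instead of the free algebra, as it does for \<open>kill_V\<close>.\<close>

lemma relation_ideal_eval:
  assumes "0 \<in> J" "\<And>x y. x \<in> J \<Longrightarrow> y \<in> J \<Longrightarrow> x + y \<in> J"
    and "\<And>x y. x \<in> J \<Longrightarrow> y * x \<in> J" "\<And>x y. x \<in> J \<Longrightarrow> x * y \<in> J"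
    and "\<And>p. p \<in> generator_relations sV \<union> R \<Longrightarrow> free_eval f p \<in> J"
    and "p \<in> relation_ideal sV R"
  shows "free_eval f p \<in> J"
proof -
  have "ideal {p. free_eval f p \<in> J} free_algebra"
    by (rule ideal_free_algebraI) (simp_all add: assms(1-4) free_eval_hom)
  then have "relation_ideal sV R \<subseteq> {p. free_eval f p \<in> J}"
    unfolding relation_ideal_def using assms(5)
    by (intro ring.genideal_minimal[OF ring_free_algebra]) auto
  then show ?thesis using assms(6) by blast
qed

lemma coeff_scale_0_left: "coeff_scale (*) 0 a = 0" for a :: "'x \<Rightarrow>\<^sub>0 'k::field"
  by (rule poly_mapping_eqI) (simp add: coeff_scale_def Poly_Mapping.map.rep_eq when_def)

lemma lookup_coeff_scale: "Poly_Mapping.lookup (coeff_scale (*) c a) x = c * Poly_Mapping.lookup a x"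
  for a :: "'x \<Rightarrow>\<^sub>0 'k::field"
  by (simp add: coeff_scale_def Poly_Mapping.map.rep_eq when_def)

lemma coeff_scale_single: "coeff_scale (*) c (Poly_Mapping.single x b) = Poly_Mapping.single x (c * b)"
  for b :: "'k::field"
  by (rule poly_mapping_eqI) (simp add: lookup_coeff_scale lookup_single when_def)

lemma sum_coeff_scale_single:
  "(\<Sum>g\<in>UNIV. coeff_scale (*) (Poly_Mapping.lookup a g) (Poly_Mapping.single g 1)) = a"
  for a :: "'g::finite \<Rightarrow>\<^sub>0 'k::field"
  by (simp add: coeff_scale_single sum_single_lookup)

lemma coeff_scale_mult_left: "coeff_scale (*) c (x * y) = coeff_scale (*) c x * y"
  and coeff_scale_mult_right: "coeff_scale (*) c (x * y) = x * coeff_scale (*) c y"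
  and coeff_scale_add: "coeff_scale (*) c (x + y) = coeff_scale (*) c x + coeff_scale (*) c y"
  and coeff_scale_diff: "coeff_scale (*) c (x - y) = coeff_scale (*) c x - coeff_scale (*) c y"
  for x y :: "'m::monoid_add \<Rightarrow>\<^sub>0 'k::field"
  by (simp_all add: coeff_scale_times mult.assoc distrib_left right_diff_distrib
      single_0_left_commute[of x c y])

lemma coeff_scale_sum: "coeff_scale (*) c (sum f A) = (\<Sum>x\<in>A. coeff_scale (*) c (f x))"
  for f :: "'a \<Rightarrow> 'm::monoid_add \<Rightarrow>\<^sub>0 'k::field"
  by (simp add: coeff_scale_times sum_distrib_left)

text \<open>Modulo such an ideal the letters from kG form a homomorphic image of kG, and the letters
  from V depend linearly on the vector. The ideals of S(V) \<rtimes> G and of H are both of this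
  kind.\<close>

locale gen_ideal = free_ideal J
  for sV :: "'k::field \<Rightarrow> 'v::ab_group_add \<Rightarrow> 'v" and J :: "('g::{group_add,finite}, 'k, 'v) tens set" +
  assumes generators: "generator_relations sV \<subseteq> J"
begin

lemma kG_add: "in_kG (a + b) \<asymp> in_kG a + in_kG b"
  and kG_scale: "in_kG (coeff_scale (*) c a) \<asymp> coeff_scale (*) c (in_kG a)"
  and kG_mult: "in_kG (a * b) \<asymp> in_kG a * in_kG b"
  and kG_one: "in_kG 1 \<asymp> 1"
  and V_add: "in_V (v + w) \<asymp> in_V v + in_V w"
  and V_scale: "in_V (sV c v) \<asymp> coeff_scale (*) c (in_V v)"
  using generators unfolding cong_def generator_relations_def diff_diff_eq[symmetric] by blast+

text \<open>The element \<open>in_kG 0\<close> is a one-letter word and not the zero of the free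
  algebra; it vanishes only modulo the ideal.\<close>

lemma kG_0: "in_kG 0 \<asymp> 0"
  using kG_scale[of 0 0] by (simp add: coeff_scale_0_left)

lemma kG_diff: "in_kG (a - b) \<asymp> in_kG a - in_kG b"
proof -
  have "in_kG (a - b) + in_kG b \<asymp> in_kG (a - b + b)" by (rule cong_sym[OF kG_add])
  then show ?thesis by (simp add: cong_def algebra_simps)
qed

lemma kG_sum: "in_kG (sum f A) \<asymp> (\<Sum>x\<in>A. in_kG (f x))"
proof (induction A rule: infinite_finite_induct)
  case (insert x A)
  have "in_kG (f x + sum f A) \<asymp> in_kG (f x) + in_kG (sum f A)" by (rule kG_add)
  also have "\<dots> \<asymp> in_kG (f x) + (\<Sum>x\<in>A. in_kG (f x))" by (intro cong_add cong_refl insert)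
  finally show ?case using insert by simp
qed (simp_all add: kG_0)

lemma V_diff: "in_V (a - b) \<asymp> in_V a - in_V b"
proof -
  have "in_V (a - b) + in_V b \<asymp> in_V (a - b + b)" by (rule cong_sym[OF V_add])
  then show ?thesis by (simp add: cong_def algebra_simps)
qed

text \<open>Reduces questions about kG to group elements, for which alone relations with V are
  imposed.\<close>

lemma kG_expand: "in_kG a \<asymp> (\<Sum>g\<in>UNIV. coeff_scale (*) (Poly_Mapping.lookup a g) (in_G g))"
proof -
  have "in_kG a \<asymp> (\<Sum>g\<in>UNIV. in_kG (coeff_scale (*) (Poly_Mapping.lookup a g) (Poly_Mapping.single g 1)))"
    using kG_sum[of "\<lambda>g. coeff_scale (*) (Poly_Mapping.lookup a g) (Poly_Mapping.single g 1)" UNIV]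
    by (simp only: sum_coeff_scale_single)
  also have "\<dots> \<asymp> (\<Sum>g\<in>UNIV. coeff_scale (*) (Poly_Mapping.lookup a g) (in_G g))"
    unfolding in_G_def by (intro cong_sum kG_scale)
  finally show ?thesis .
qed

end

section \<open>Linear expressions in V with coefficients in kG, and reordering modulo the relations
  of H\<close>

definition in_VG :: "('g \<Rightarrow>\<^sub>0 'v) \<Rightarrow> ('g::finite, 'k::field, 'v::zero) tens" where
  "in_VG s = (\<Sum>g\<in>UNIV. in_V (Poly_Mapping.lookup s g) * in_G g)"

lemma in_kappa_eq: "in_kappa p = in_kG (fst p) + in_VG (snd p)"
  by (simp add: in_kappa_def in_VG_def)

text \<open>For \<open>a = \<Sum>\<^sub>g a\<^sub>g g\<close> this is
  \<open>\<Sum>\<^sub>g a\<^sub>g f\<^sub>g(v) \<otimes> g\<close>. With \<open>act\<close> it is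
  the degree 1 part of the product a v after kG is moved to the right; with the constant identity
  family it is v \<otimes> a.\<close>

definition twist ::
    "('k::field \<Rightarrow> 'v::ab_group_add \<Rightarrow> 'v) \<Rightarrow> ('g \<Rightarrow> 'v \<Rightarrow> 'v) \<Rightarrow> ('g::finite \<Rightarrow>\<^sub>0 'k) \<Rightarrow> 'v \<Rightarrow> ('g \<Rightarrow>\<^sub>0 'v)" where
  "twist sV f a v = (\<Sum>g\<in>UNIV. Poly_Mapping.single g (sV (Poly_Mapping.lookup a g) (f g v)))"

lemma lookup_twist: "Poly_Mapping.lookup (twist sV f a v) g = sV (Poly_Mapping.lookup a g) (f g v)"
  by (simp add: twist_def lookup_sum lookup_single when_def)

text \<open>The map v \<otimes> g \<mapsto> \<gamma>(v) g, which is the degree 0 term that appears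
  when v is replaced by v + \<gamma>(v).\<close>

definition contract :: "('v \<Rightarrow> ('g \<Rightarrow>\<^sub>0 'k)) \<Rightarrow> ('g \<Rightarrow>\<^sub>0 'v::ab_group_add) \<Rightarrow> ('g::{group_add,finite} \<Rightarrow>\<^sub>0 'k::field)" where
  "contract \<gamma> s = (\<Sum>g\<in>UNIV. \<gamma> (Poly_Mapping.lookup s g) * Poly_Mapping.single g 1)"

context gen_ideal begin

lemma VG_add: "in_VG (s + t) \<asymp> in_VG s + in_VG t"
  unfolding in_VG_def lookup_add sum.distrib[symmetric] distrib_right[symmetric]
  by (intro cong_sum cong_mult V_add cong_refl)

lemma VG_diff: "in_VG (s - t) \<asymp> in_VG s - in_VG t"
  unfolding in_VG_def lookup_minus sum_subtractf[symmetric] left_diff_distrib[symmetric]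
  by (intro cong_sum cong_mult V_diff cong_refl)

lemma VG_twist: "in_VG (twist sV f a v) \<asymp>
  (\<Sum>g\<in>UNIV. coeff_scale (*) (Poly_Mapping.lookup a g) (in_V (f g v) * in_G g))"
  unfolding in_VG_def lookup_twist coeff_scale_mult_left
  by (intro cong_sum cong_mult V_scale cong_refl)

lemma VG_tensor: "in_VG (twist sV (\<lambda>_ v. v) a v) \<asymp> in_V v * in_kG a"
proof -
  have "in_VG (twist sV (\<lambda>_ v. v) a v) \<asymp>
    in_V v * (\<Sum>g\<in>UNIV. coeff_scale (*) (Poly_Mapping.lookup a g) (in_G g))"
    using VG_twist[of "\<lambda>_ v. v" a v] by (simp add: coeff_scale_mult_right sum_distrib_left)
  also have "\<dots> \<asymp> in_V v * in_kG a"
    by (intro cong_mult cong_refl cong_sym[OF kG_expand])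
  finally show ?thesis .
qed

lemma kG_contract: "in_kG (contract \<gamma> s) \<asymp> (\<Sum>g\<in>UNIV. in_kG (\<gamma> (Poly_Mapping.lookup s g)) * in_G g)"
  unfolding contract_def in_G_def
  by (rule cong_trans[OF kG_sum]) (intro cong_sum kG_mult)

end

text \<open>The relations mention \<lambda> at group elements only; linearity in its first argument
  extends them to all of kG.\<close>

locale H_ideal = gen_ideal sV J
  for sV :: "'k::field \<Rightarrow> 'v::ab_group_add \<Rightarrow> 'v" and J :: "('g::{group_add,finite}, 'k, 'v) tens set" +
  fixes act :: "'g \<Rightarrow> 'v \<Rightarrow> 'v" and lam and \<kappa>
  assumes relations: "H_relations act lam \<kappa> \<subseteq> J"
    and lam_add_left: "lam (a + b) v = lam a v + lam b v"
    and lam_scale_left: "lam (coeff_scale (*) c a) v = coeff_scale (*) c (lam a v)"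
begin

lemma group_relation: "in_G g * in_V v \<asymp> in_V (act g v) * in_G g + in_kG (lam (Poly_Mapping.single g 1) v)"
  and V_relation: "in_V v * in_V w - in_V w * in_V v \<asymp> in_kappa (\<kappa> v w)"
  using relations by (auto simp: cong_def H_relations_def diff_diff_eq)

lemma lam_sum_left: "lam (sum f A) v = (\<Sum>x\<in>A. lam (f x) v)"
proof -
  have "lam 0 v = 0" using lam_add_left[of 0 0 v] by simp
  then show ?thesis
    by (induction A rule: infinite_finite_induct) (simp_all add: lam_add_left)
qed

text \<open>Linear extension of the group relation. It is needed for products \<gamma>(v) w, whose
  left factor is a general element of kG.\<close>

lemma kG_V: "in_kG a * in_V v \<asymp> in_VG (twist sV act a v) + in_kG (lam a v)"
proof -
  let ?c = "Poly_Mapping.lookup a"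
  let ?e = "\<lambda>g. Poly_Mapping.single g 1"
  have "in_kG a * in_V v \<asymp> (\<Sum>g\<in>UNIV. coeff_scale (*) (?c g) (in_G g)) * in_V v"
    by (intro cong_mult kG_expand cong_refl)
  also have "\<dots> = (\<Sum>g\<in>UNIV. coeff_scale (*) (?c g) (in_G g * in_V v))"
    by (simp add: sum_distrib_right coeff_scale_mult_left)
  also have "\<dots> \<asymp> (\<Sum>g\<in>UNIV. coeff_scale (*) (?c g) (in_V (act g v) * in_G g + in_kG (lam (?e g) v)))"
    by (intro cong_sum cong_scale group_relation)
  also have "\<dots> = (\<Sum>g\<in>UNIV. coeff_scale (*) (?c g) (in_V (act g v) * in_G g))
    + (\<Sum>g\<in>UNIV. coeff_scale (*) (?c g) (in_kG (lam (?e g) v)))"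
    by (simp add: coeff_scale_add sum.distrib)
  also have "\<dots> \<asymp> in_VG (twist sV act a v) + in_kG (lam a v)"
  proof (rule cong_add[OF cong_sym[OF VG_twist] cong_sym])
    have "in_kG (lam a v) = in_kG (\<Sum>g\<in>UNIV. coeff_scale (*) (?c g) (lam (?e g) v))"
      by (simp flip: lam_scale_left lam_sum_left add: sum_coeff_scale_single)
    also have "\<dots> \<asymp> (\<Sum>g\<in>UNIV. in_kG (coeff_scale (*) (?c g) (lam (?e g) v)))" by (rule kG_sum)
    also have "\<dots> \<asymp> (\<Sum>g\<in>UNIV. coeff_scale (*) (?c g) (in_kG (lam (?e g) v)))"
      by (intro cong_sum kG_scale)
    finally show "in_kG (lam a v) \<asymp> (\<Sum>g\<in>UNIV. coeff_scale (*) (?c g) (in_kG (lam (?e g) v)))" .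
  qed
  finally show ?thesis .
qed

end

text \<open>In the quotient v' = v + \<gamma>(v) satisfies g v' = (g\<cdot>v)' g + \<lambda>(g, v) +
  g \<gamma>(v) - \<gamma>(g\<cdot>v) g. The last three terms, extended linearly from g to kG, are
  the new parameter.\<close>

definition shift_lam where
  "shift_lam sV act \<gamma> lam a v = lam a v + a * \<gamma> v - contract \<gamma> (twist sV act a v)"

text \<open>The degree 1 part of v \<gamma>(w) - w \<gamma>(v) + \<gamma>(v) w - \<gamma>(w) v with
  kG moved to the right. These are the mixed terms in the commutator of v + \<gamma>(v) and w +
  \<gamma>(w).\<close>

definition shift_linear_part where
  "shift_linear_part sV act \<gamma> v w =
     twist sV (\<lambda>_ v. v) (\<gamma> w) v - twist sV (\<lambda>_ v. v) (\<gamma> v) w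
     + twist sV act (\<gamma> v) w - twist sV act (\<gamma> w) v"

text \<open>The commutator of v' = v + \<gamma>(v) and w' = w + \<gamma>(w), expressed through
  primed vectors. Moving \<gamma>(v) past w leaves the \<lambda> terms, and \<open>contract\<close>
  is subtracted because each u g in the degree 1 part becomes u' g - \<gamma>(u) g.\<close>

definition shift_kappa where
  "shift_kappa sV act \<gamma> lam \<kappa> v w =
     (fst (\<kappa> v w) + lam (\<gamma> v) w - lam (\<gamma> w) v + \<gamma> v * \<gamma> w - \<gamma> w * \<gamma> v
        - contract \<gamma> (snd (\<kappa> v w) + shift_linear_part sV act \<gamma> v w),
      snd (\<kappa> v w) + shift_linear_part sV act \<gamma> v w)"

definition shift_letter ::
    "('v \<Rightarrow> ('g \<Rightarrow>\<^sub>0 'k)) \<Rightarrow> ('g \<Rightarrow>\<^sub>0 'k) + 'v \<Rightarrow> ('g, 'k::field, 'v) tens" where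
  "shift_letter \<gamma> x = (case x of Inl a \<Rightarrow> in_kG a | Inr v \<Rightarrow> in_V v + in_kG (\<gamma> v))"

lemma shift_letter_simps [simp]:
  "shift_letter \<gamma> (Inl a) = in_kG a" "shift_letter \<gamma> (Inr v) = in_V v + in_kG (\<gamma> v)"
  by (simp_all add: shift_letter_def)

lemma in_kG_single: "in_kG (Poly_Mapping.single g 1) = in_G g"
  by (simp add: in_G_def)

context H_ideal begin

lemma eval_shift_in_VG: "free_eval (shift_letter \<gamma>) (in_VG s) \<asymp> in_VG s + in_kG (contract \<gamma> s)"
  using cong_add[OF cong_refl cong_sym[OF kG_contract]]
  by (simp add: in_VG_def free_eval_hom distrib_right sum.distrib in_kG_single)

lemma shift_group_relation:
  assumes "\<And>c x. \<gamma> (sV c x) = coeff_scale (*) c (\<gamma> x)"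
  shows "free_eval (shift_letter \<gamma>) (in_G g * in_V v - in_V (act g v) * in_G g
     - in_kG (shift_lam sV act \<gamma> lam (Poly_Mapping.single g 1) v)) \<in> J"
proof -
  let ?e = "Poly_Mapping.single g 1"
  \<comment> \<open>For a single group element the sum collapses to one term: all other coefficients
    are 0, and homogeneity of \<gamma> gives \<gamma>(0 u) = 0.\<close>
  have c: "contract \<gamma> (twist sV act ?e v) = \<gamma> (act g v) * ?e"
  proof -
    have "\<gamma> (sV (1 when g = h) (act h v)) * Poly_Mapping.single h 1 =
        (if h = g then \<gamma> (act g v) * ?e else 0)" for h
      by (simp add: assms coeff_scale_times when_def)
    then show ?thesis by (simp add: contract_def lookup_twist lookup_single)
  qed
  have 1: "in_G g * in_V v \<asymp> in_V (act g v) * in_G g + in_kG (lam ?e v)"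
    by (rule group_relation)
  have 2: "in_kG (shift_lam sV act \<gamma> lam ?e v) \<asymp> in_kG (lam ?e v) + in_kG ?e * in_kG (\<gamma> v) - in_kG (\<gamma> (act g v)) * in_kG ?e"
    unfolding shift_lam_def c
    by (intro cong_trans[OF kG_diff] cong_diff kG_mult cong_trans[OF kG_add] cong_add cong_refl)
  show ?thesis
    using cong_diff[OF 1 2]
    by (simp add: free_eval_hom in_kG_single cong_def algebra_simps)
qed

lemma shift_V_relation:
  "free_eval (shift_letter \<gamma>) (in_V v * in_V w - in_V w * in_V v
     - in_kappa (shift_kappa sV act \<gamma> lam \<kappa> v w)) \<in> J"
proof -
  define K where "K = snd (\<kappa> v w)"
  define L where "L = K + shift_linear_part sV act \<gamma> v w"
  define C where "C = fst (shift_kappa sV act \<gamma> lam \<kappa> v w)"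
  have sk: "shift_kappa sV act \<gamma> lam \<kappa> v w = (C, L)"
    by (simp add: shift_kappa_def C_def L_def K_def)
  let ?k = "in_kG :: _ \<Rightarrow> ('g, 'k, 'v) tens"
  let ?T = "\<lambda>v a. in_VG (twist sV (\<lambda>_ v. v) a v) :: ('g, 'k, 'v) tens"
  let ?A = "\<lambda>a v. in_VG (twist sV act a v) :: ('g, 'k, 'v) tens"
  have C: "?k C \<asymp> ?k (fst (\<kappa> v w)) + ?k (lam (\<gamma> v) w) - ?k (lam (\<gamma> w) v)
      + ?k (\<gamma> v) * ?k (\<gamma> w) - ?k (\<gamma> w) * ?k (\<gamma> v) - ?k (contract \<gamma> L)"
    unfolding C_def shift_kappa_def fst_conv L_def K_def
    by (intro cong_trans[OF kG_diff] cong_diff kG_mult cong_trans[OF kG_add] cong_add cong_refl)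
  have L: "in_VG L \<asymp> in_VG K + (?T v (\<gamma> w) - ?T w (\<gamma> v) + ?A (\<gamma> v) w - ?A (\<gamma> w) v)"
    unfolding L_def shift_linear_part_def
    by (intro cong_trans[OF VG_diff] cong_diff cong_trans[OF VG_add] cong_add cong_refl)
  have "free_eval (shift_letter \<gamma>) (in_kappa (C, L)) \<asymp> ?k C + (in_VG L + ?k (contract \<gamma> L))"
    using eval_shift_in_VG by (simp add: in_kappa_eq free_eval_hom cong_add)
  also have "\<dots> \<asymp> (?k (fst (\<kappa> v w)) + ?k (lam (\<gamma> v) w) - ?k (lam (\<gamma> w) v)
      + ?k (\<gamma> v) * ?k (\<gamma> w) - ?k (\<gamma> w) * ?k (\<gamma> v) - ?k (contract \<gamma> L))
      + (in_VG K + (?T v (\<gamma> w) - ?T w (\<gamma> v) + ?A (\<gamma> v) w - ?A (\<gamma> w) v) + ?k (contract \<gamma> L))"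
    by (intro cong_add C L cong_refl)
  \<comment> \<open>The two contractions cancel, which explains their sign in
    \<open>shift_kappa\<close>. The rest is grouped so that each bracket is a right-hand side of
    \<open>kG_V\<close>.\<close>
  also have "\<dots> = in_kappa (\<kappa> v w) + ?T v (\<gamma> w) - ?T w (\<gamma> v)
      + (?A (\<gamma> v) w + ?k (lam (\<gamma> v) w)) - (?A (\<gamma> w) v + ?k (lam (\<gamma> w) v))
      + ?k (\<gamma> v) * ?k (\<gamma> w) - ?k (\<gamma> w) * ?k (\<gamma> v)"
    by (simp add: in_kappa_eq K_def algebra_simps)
  also have "\<dots> \<asymp> (in_V v * in_V w - in_V w * in_V v) + in_V v * ?k (\<gamma> w) - in_V w * ?k (\<gamma> v)
      + ?k (\<gamma> v) * in_V w - ?k (\<gamma> w) * in_V v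
      + ?k (\<gamma> v) * ?k (\<gamma> w) - ?k (\<gamma> w) * ?k (\<gamma> v)"
    by (intro cong_add cong_diff cong_refl VG_tensor cong_sym[OF kG_V] cong_sym[OF V_relation])
  also have "\<dots> = free_eval (shift_letter \<gamma>) (in_V v * in_V w - in_V w * in_V v)"
    by (simp add: free_eval_hom algebra_simps)
  finally have "free_eval (shift_letter \<gamma>) (in_kappa (C, L)) \<asymp>
    free_eval (shift_letter \<gamma>) (in_V v * in_V w - in_V w * in_V v)" .
  from cong_sym[OF this] show ?thesis
    unfolding sk free_eval_diff cong_def .
qed


text \<open>Makes v \<mapsto> v + \<gamma>(v) descend to a homomorphism from the algebra with
  shifted parameters to the one with the given parameters. Linearity of \<gamma> takes care of the
  linear relations on V.\<close>

lemma shift_eval: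
  assumes scale: "\<And>c x. \<gamma> (sV c x) = coeff_scale (*) c (\<gamma> x)"
    and add: "\<And>x y. \<gamma> (x + y) = \<gamma> x + \<gamma> y"
    and p: "p \<in> relation_ideal sV (H_relations act (shift_lam sV act \<gamma> lam) (shift_kappa sV act \<gamma> lam \<kappa>))"
  shows "free_eval (shift_letter \<gamma>) p \<in> J"
proof (rule relation_ideal_eval[OF mem_0 mem_add mem_lmult mem_rmult _ p])
  fix p
  assume "p \<in> generator_relations sV \<union>
    H_relations act (shift_lam sV act \<gamma> lam) (shift_kappa sV act \<gamma> lam \<kappa>)"
  moreover have "in_V (v + w) + in_kG (\<gamma> (v + w)) - (in_V v + in_kG (\<gamma> v)) - (in_V w + in_kG (\<gamma> w)) \<in> J" for v w
    using cong_add[OF V_add[of v w] kG_add[of "\<gamma> v" "\<gamma> w"]] by (simp add: cong_def add algebra_simps)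
  moreover have "in_V (sV c v) + in_kG (\<gamma> (sV c v)) - coeff_scale (*) c (in_V v + in_kG (\<gamma> v)) \<in> J" for c v
    using cong_add[OF V_scale[of c v] kG_scale[of c "\<gamma> v"]]
    by (simp add: cong_def scale coeff_scale_add algebra_simps)
  ultimately show "free_eval (shift_letter \<gamma>) p \<in> J"
    using kG_add kG_scale kG_mult kG_one shift_group_relation[OF scale] shift_V_relation
    unfolding cong_def generator_relations_def H_relations_def
    by (auto simp: free_eval_diff free_eval_mult free_eval_add free_eval_scale diff_diff_eq)
qed

end

section \<open>Filtration by degree\<close>

definition deg_le :: "nat \<Rightarrow> ('g, 'k::field, 'v) tens \<Rightarrow> bool" where
  "deg_le n p \<longleftrightarrow> (\<forall>w\<in>Poly_Mapping.keys p. V_degree w \<le> n)"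

lemma V_degree_plus: "V_degree (u + w) = V_degree u + V_degree w"
  by (simp add: V_degree_def plus_free_monoid_def)

lemma deg_le_mono: "deg_le m p \<Longrightarrow> m \<le> n \<Longrightarrow> deg_le n p"
  by (auto simp: deg_le_def intro: order_trans)

lemma deg_le_0 [simp]: "deg_le n 0"
  by (simp add: deg_le_def)

lemma deg_le_add: "deg_le n p \<Longrightarrow> deg_le n q \<Longrightarrow> deg_le n (p + q)"
  using Poly_Mapping.keys_add[of p q] by (auto simp: deg_le_def)

lemma deg_le_sum: "(\<And>x. x \<in> A \<Longrightarrow> deg_le n (f x)) \<Longrightarrow> deg_le n (sum f A)"
  by (induction A rule: infinite_finite_induct) (simp_all add: deg_le_add)

lemma deg_le_mult:
  assumes "deg_le m p" "deg_le n q" shows "deg_le (m + n) (p * q)"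
  unfolding deg_le_def
proof
  fix w assume "w \<in> Poly_Mapping.keys (p * q)"
  then obtain a b where "w = a + b" "a \<in> Poly_Mapping.keys p" "b \<in> Poly_Mapping.keys q"
    using keys_mult[of p q] by blast
  then show "V_degree w \<le> m + n"
    using assms by (auto simp: deg_le_def V_degree_plus intro: add_mono)
qed

lemma deg_le_scalar: "deg_le n (Poly_Mapping.single 0 c)"
  by (simp add: deg_le_def V_degree_def zero_free_monoid_def)

lemma deg_le_scale: "deg_le n p \<Longrightarrow> deg_le n (coeff_scale (*) c p)"
  using deg_le_mult[OF deg_le_scalar[of 0 c]] by (simp add: coeff_scale_times)

lemma deg_le_uminus: "deg_le n p \<Longrightarrow> deg_le n (- p)"
  using deg_le_scale[of n p "- 1"] by (simp add: coeff_scale_times single_uminus)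

lemma deg_le_in_kG: "deg_le n (in_kG a)"
  and deg_le_in_V: "deg_le 1 (in_V v)"
  by (simp_all add: deg_le_def in_kG_def in_V_def V_degree_def)

lemma deg_le_word_eval:
  assumes "\<And>x. deg_le (V_degree (Word [x])) (f x)"
  shows "deg_le (V_degree w) (word_eval f w)"
proof -
  have "deg_le (V_degree (Word xs)) (word_eval f (Word xs))" for xs
  proof (induction xs)
    case Nil
    show ?case using deg_le_scalar[of 0 1] by (simp add: word_eval_def V_degree_def)
  next
    case (Cons x xs)
    have "V_degree (Word (x # xs)) = V_degree (Word [x]) + V_degree (Word xs)"
      by (simp add: V_degree_def)
    then show ?case
      using deg_le_mult[OF assms[of x] Cons] by (simp add: word_eval_def)
  qed
  from this[of "letters w"] show ?thesis by simp
qed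

text \<open>Replacing letters by expressions of no larger degree cannot raise the degree. Applied to
  v + \<gamma>(v), where \<gamma>(v) has degree 0, this makes the isomorphisms filtered.\<close>

lemma deg_le_free_eval:
  assumes "\<And>x. deg_le (V_degree (Word [x])) (f x)" "deg_le n p"
  shows "deg_le n (free_eval f p)"
  unfolding free_eval_def
proof (rule deg_le_sum)
  fix w assume "w \<in> Poly_Mapping.keys p"
  then have "V_degree w \<le> n"
    using assms(2) by (simp add: deg_le_def)
  then have "deg_le n (word_eval f w)"
    by (rule deg_le_mono[OF deg_le_word_eval[OF assms(1)]])
  then show "deg_le n (Poly_Mapping.single 0 (Poly_Mapping.lookup p w) * word_eval f w)"
    using deg_le_mult[OF deg_le_scalar[of 0]] by fastforce
qed

lemma degree_le_eq: "degree_le sV R n = free_ideal.cls (relation_ideal sV R) ` {p. deg_le n p}"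
  unfolding degree_le_def deg_le_def
  by (intro image_cong) (simp_all add: free_ideal.cls_def[OF relation_ideal_free_ideal])

lemma coeff_scale_zero_right: "coeff_scale (*) c 0 = 0" for c :: "'k::field"
  by (rule poly_mapping_eqI) (simp add: lookup_coeff_scale)

lemma presented_filtered_algebra:
  fixes sV :: "'k::field \<Rightarrow> 'v::ab_group_add \<Rightarrow> 'v" and R :: "('g::group_add, 'k, 'v) tens set"
  shows "filtered_algebra (presented_algebra sV R) (degree_le sV R)"
proof -
  define J where "J = relation_ideal sV R"
  interpret J: free_ideal J unfolding J_def by (rule relation_ideal_free_ideal)
  interpret Q: ring J.Q by (rule J.Q_ring)
  have F: "degree_le sV R n = J.cls ` {p. deg_le n p}" for n
    by (simp add: degree_le_eq J_def)
  have minus: "\<ominus>\<^bsub>J.Q\<^esub> J.cls p = J.cls (- p)" for p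
    by (rule Q.minus_equality) (simp_all add: J.cls_carrier J.Q_add J.Q_zero)
  have "filtered_algebra J.Q (degree_le sV R)"
  proof (intro filtered_algebra.intro filtered_algebra_axioms.intro)
    show "ring J.Q" by (rule J.Q_ring)
  next
    fix n
    show "additive_subgroup (degree_le sV R n) J.Q"
    proof (rule additive_subgroup.intro, rule Q.add.subgroupI)
      show "degree_le sV R n \<subseteq> carrier J.Q"
        by (auto simp: F J.cls_carrier)
      show "degree_le sV R n \<noteq> {}"
        using deg_le_0 unfolding F by blast
    next
      fix a assume "a \<in> degree_le sV R n"
      then show "\<ominus>\<^bsub>J.Q\<^esub> a \<in> degree_le sV R n"
        by (auto simp: F minus deg_le_uminus)
    next
      fix a b assume "a \<in> degree_le sV R n" "b \<in> degree_le sV R n"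
      then show "a \<oplus>\<^bsub>J.Q\<^esub> b \<in> degree_le sV R n"
        by (auto simp: F J.Q_add deg_le_add)
    qed
    show "degree_le sV R n \<subseteq> degree_le sV R (Suc n)"
      unfolding F by (intro image_mono Collect_mono) (simp add: deg_le_mono)
  next
    fix x y m n assume "x \<in> degree_le sV R m" "y \<in> degree_le sV R n"
    then show "x \<otimes>\<^bsub>J.Q\<^esub> y \<in> degree_le sV R (m + n)"
      by (auto simp: F J.Q_mult deg_le_mult)
  next
    fix x n c assume "x \<in> degree_le sV R n"
    then show "c \<odot>\<^bsub>J.Q\<^esub> x \<in> degree_le sV R n"
      by (auto simp: F J.Q_smult deg_le_scale)
  next
    fix x c assume "x \<in> carrier J.Q"
    then show "c \<odot>\<^bsub>J.Q\<^esub> x \<in> carrier J.Q"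
      by (auto simp: J.Q_carrier J.Q_smult)
  next
    fix c show "c \<odot>\<^bsub>J.Q\<^esub> \<zero>\<^bsub>J.Q\<^esub> = \<zero>\<^bsub>J.Q\<^esub>"
      by (simp add: J.Q_zero J.Q_smult coeff_scale_zero_right)
  qed
  then show ?thesis by (simp add: presented_algebra_def J_def)
qed

text \<open>Algebra maps that agree on letters modulo an ideal agree modulo it everywhere. The
  substitutions by \<gamma> and -\<gamma> are compared in this sense, since a sum of letters from kG
  need not collapse in the free algebra.\<close>

lemma eval_eval_cong:
  assumes "free_ideal J" "\<And>x. free_eval f' (f x) - Poly_Mapping.single (Word [x]) 1 \<in> J"
  shows "free_eval f' (free_eval f p) - p \<in> J"
proof -
  interpret free_ideal J by fact
  have "free_eval f' (free_eval f p) \<asymp> p"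
  proof (induction p rule: free_algebra_induct)
    case (letter x) then show ?case using assms(2) by (simp add: cong_def)
  qed (simp_all add: free_eval_hom cong_add cong_mult)
  then show ?thesis by (simp add: cong_def)
qed

lemma presented_filtered_isomorphic:
  fixes f f' :: "('g::group_add \<Rightarrow>\<^sub>0 'k) + 'v \<Rightarrow> ('g, 'k::field, 'v::ab_group_add) tens"
    and sV :: "'k \<Rightarrow> 'v \<Rightarrow> 'v" and R R' :: "('g, 'k, 'v) tens set"
  defines "I \<equiv> relation_ideal sV R" and "J \<equiv> relation_ideal sV R'"
  assumes f: "\<And>p. p \<in> I \<Longrightarrow> free_eval f p \<in> J" and f': "\<And>p. p \<in> J \<Longrightarrow> free_eval f' p \<in> I"
    and ff': "\<And>x. free_eval f' (f x) - Poly_Mapping.single (Word [x]) 1 \<in> I"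
    and f'f: "\<And>x. free_eval f (f' x) - Poly_Mapping.single (Word [x]) 1 \<in> J"
    and deg: "\<And>x. deg_le (V_degree (Word [x])) (f x)" "\<And>x. deg_le (V_degree (Word [x])) (f' x)"
  shows "\<exists>\<phi>. filtered_algebra_iso (presented_algebra sV R) (degree_le sV R)
    (presented_algebra sV R') (degree_le sV R') \<phi>"
proof -
  interpret I: free_ideal I unfolding I_def by (rule relation_ideal_free_ideal)
  interpret J: free_ideal J unfolding J_def by (rule relation_ideal_free_ideal)
  \<comment> \<open>Any representative will do, because the substitution maps \<open>I\<close> into
    \<open>J\<close>.\<close>
  define \<phi> where "\<phi> C = J.cls (free_eval f (SOME p. I.cls p = C))" for C
  have \<phi>: "\<phi> (I.cls p) = J.cls (free_eval f p)" for p
  proof -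
    have "I.cls (SOME q. I.cls q = I.cls p) = I.cls p" by (rule someI) simp
    then show ?thesis
      using f by (simp add: \<phi>_def I.cls_eq_iff J.cls_eq_iff flip: free_eval_diff)
  qed
  have retract: "J.cls (free_eval f (free_eval f' q)) = J.cls q" for q
    using eval_eval_cong[OF J.free_ideal_axioms f'f] by (simp add: J.cls_eq_iff)
  have bij: "bij_betw \<phi> (carrier I.Q) (carrier J.Q)"
  proof (rule bij_betw_imageI)
    show "inj_on \<phi> (carrier I.Q)"
    proof (rule inj_onI)
      fix x y assume "x \<in> carrier I.Q" "y \<in> carrier I.Q" and eq: "\<phi> x = \<phi> y"
      then obtain p q where xy: "x = I.cls p" "y = I.cls q" by (auto simp: I.Q_carrier)
      have "free_eval f (p - q) \<in> J"
        using eq by (simp add: xy \<phi> J.cls_eq_iff free_eval_diff)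
      then have "free_eval f' (free_eval f (p - q)) \<in> I" by (rule f')
      moreover have "free_eval f' (free_eval f (p - q)) - (p - q) \<in> I"
        by (rule eval_eval_cong[OF I.free_ideal_axioms ff'])
      ultimately have "p - q \<in> I"
        using I.mem_diff[of "free_eval f' (free_eval f (p - q))"] by fastforce
      then show "x = y" by (simp add: xy I.cls_eq_iff)
    qed
    show "\<phi> ` carrier I.Q = carrier J.Q"
      using retract by (force simp: I.Q_carrier J.Q_carrier \<phi> image_iff)
  qed
  have "\<phi> \<in> ring_iso I.Q J.Q"
    by (rule ring_iso_memI)
      (use bij in \<open>auto simp: I.Q_carrier J.Q_carrier \<phi> I.Q_add I.Q_mult I.Q_one J.Q_add J.Q_mult J.Q_one free_eval_hom\<close>)
  then have iso: "\<phi> \<in> algebra_iso I.Q J.Q"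
    by (auto simp: algebra_iso_def I.Q_carrier \<phi> I.Q_smult J.Q_smult free_eval_hom)
  have image: "\<phi> ` degree_le sV R n = degree_le sV R' n" for n
  proof -
    \<comment> \<open>The inverse substitution respects degree too, so a class in a layer of the
      target has a preimage in the same layer. Without this only an inclusion of layers would
      follow.\<close>
    have "J.cls q \<in> \<phi> ` I.cls ` {p. deg_le n p}" if "deg_le n q" for q
    proof -
      have "J.cls q = \<phi> (I.cls (free_eval f' q))" by (simp add: \<phi> retract)
      moreover have "deg_le n (free_eval f' q)" by (rule deg_le_free_eval[OF deg(2) that])
      ultimately show ?thesis by blast
    qed
    moreover have "deg_le n (free_eval f p)" if "deg_le n p" for p
      by (rule deg_le_free_eval[OF deg(1) that])
    ultimately show ?thesis
      by (auto simp: degree_le_eq \<phi> simp flip: I_def J_def)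
  qed
  have "filtered_algebra_iso (presented_algebra sV R) (degree_le sV R)
    (presented_algebra sV R') (degree_le sV R') \<phi>"
    by (intro filtered_algebra_iso.intro presented_filtered_algebra filtered_algebra_iso_axioms.intro)
      (use iso image in \<open>simp_all add: presented_algebra_def I_def J_def\<close>)
  then show ?thesis by blast
qed

section \<open>The group algebra embeds in a PBW deformation\<close>

lemma vector_space_coeff_scale: "vector_space (coeff_scale (*) :: 'k::field \<Rightarrow> ('x \<Rightarrow>\<^sub>0 'k) \<Rightarrow> ('x \<Rightarrow>\<^sub>0 'k))"
  by unfold_locales
    (simp_all add: poly_mapping_eq_iff fun_eq_iff lookup_coeff_scale lookup_add algebra_simps)

text \<open>Finiteness of G makes the group elements a finite basis of kG, so the dimension argument
  for endomorphisms applies.\<close>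

lemma coeff_scale_linear_surj_imp_inj:
  fixes T :: "('g::finite \<Rightarrow>\<^sub>0 'k::field) \<Rightarrow> ('g \<Rightarrow>\<^sub>0 'k)"
  assumes add: "\<And>a b. T (a + b) = T a + T b"
    and scale: "\<And>c a. T (coeff_scale (*) c a) = coeff_scale (*) c (T a)"
    and "surj T"
  shows "inj T"
proof -
  let ?s = "coeff_scale (*) :: 'k \<Rightarrow> ('g \<Rightarrow>\<^sub>0 'k) \<Rightarrow> ('g \<Rightarrow>\<^sub>0 'k)"
  let ?e = "\<lambda>g::'g. Poly_Mapping.single g (1::'k)"
  interpret vs: vector_space ?s by (rule vector_space_coeff_scale)
  have inj: "inj ?e" by (auto simp: inj_on_def single_def when_def poly_mapping_eq_iff fun_eq_iff)
  have indep: "\<not> vs.dependent (range ?e)"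
  proof (rule vs.independent_if_scalars_zero)
    fix f :: "('g \<Rightarrow>\<^sub>0 'k) \<Rightarrow> 'k" and x
    assume sum: "(\<Sum>x\<in>range ?e. ?s (f x) x) = 0" and "x \<in> range ?e"
    then obtain g where g: "x = ?e g" by blast
    have "(\<Sum>h\<in>UNIV. Poly_Mapping.single h (f (?e h))) = 0"
      using sum by (simp add: sum.reindex[OF inj] coeff_scale_single)
    then have "Poly_Mapping.lookup (\<Sum>h\<in>UNIV. Poly_Mapping.single h (f (?e h))) g = 0"
      by simp
    then show "f x = 0" by (simp add: g lookup_sum lookup_single when_def)
  qed simp
  have "a \<in> vs.span (range ?e)" for a
  proof -
    have "(\<Sum>g\<in>UNIV. ?s (Poly_Mapping.lookup a g) (?e g)) \<in> vs.span (range ?e)"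
      by (intro vs.span_sum vs.span_scale vs.span_base) simp
    then show ?thesis by (simp add: sum_coeff_scale_single)
  qed
  then interpret fd: finite_dimensional_vector_space ?s "range ?e"
    by unfold_locales (use indep in auto)
  have "Vector_Spaces.linear ?s ?s T"
    using vs.vector_space_axioms by (simp add: Vector_Spaces.linear_iff add scale)
  then show ?thesis by (rule fd.linear_surj_imp_inj) fact
qed

section \<open>The degree 0 component of an associated graded algebra\<close>

context filtered_algebra begin

lemma Fb_smult: "x \<in> Fb n \<Longrightarrow> c \<odot>\<^bsub>A\<^esub> x \<in> Fb n"
  using F_smult smult_zero by (auto simp: filt_below_def split: nat.splits)

text \<open>Identifies \<open>F 0\<close> with the degree 0 component. As \<open>Fb 0\<close> is
  zero, the entry at 0 is the singleton of x and nothing is lost.\<close>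

definition degree_0 :: "'a \<Rightarrow> nat \<Rightarrow> 'a set" where
  "degree_0 x n = (if n = 0 then Fb 0 +> x else Fb n)"

lemma zero_coset: "x \<in> carrier A \<Longrightarrow> Fb 0 +> x = {x}"
  by (simp add: filt_below_def a_r_coset_def')

lemma degree_0_component:
  assumes "x \<in> F 0" shows "degree_0 x \<in> assoc_graded_component A F 0"
proof -
  have "\<exists>y\<in>F n. degree_0 x n = Fb n +> y" for n
    using assms additive_subgroup.zero_closed[OF F_additive, of n]
    a_coset_add_zero[OF Fb_subset, of n]
    by (cases "n = 0") (force simp: degree_0_def)+
  moreover have "finite {n. degree_0 x n \<noteq> Fb n}"
    by (rule finite_subset[of _ "{0}"]) (auto simp: degree_0_def)
  ultimately show ?thesis
    by (simp add: assoc_graded_component_def graded_carrier) (simp add: degree_0_def)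
qed

lemma degree_0_component_cases:
  assumes "a \<in> assoc_graded_component A F 0"
  obtains x where "x \<in> F 0" "a = degree_0 x"
proof -
  have "\<forall>n. \<exists>x\<in>F n. a n = Fb n +> x"
    using assms by (simp add: assoc_graded_component_def graded_carrier)
  then obtain x where "x \<in> F 0" "a 0 = Fb 0 +> x" by blast
  with assms have "a = degree_0 x"
    by (auto simp: degree_0_def assoc_graded_component_def fun_eq_iff)
  with \<open>x \<in> F 0\<close> show ?thesis by (rule that)
qed

lemma degree_0_add:
  assumes "x \<in> carrier A" "y \<in> carrier A"
  shows "degree_0 (x \<oplus> y) = degree_0 x \<oplus>\<^bsub>assoc_graded A F\<^esub> degree_0 y"
proof (rule ext)
  fix n
  have "Fb n <+> Fb n = Fb n"
    using Fb.a_rcos_sum[of \<zero> \<zero> n] a_coset_add_zero[OF Fb_subset] by simp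
  then show "degree_0 (x \<oplus> y) n = (degree_0 x \<oplus>\<^bsub>assoc_graded A F\<^esub> degree_0 y) n"
    using Fb.a_rcos_sum[OF assms] by (simp add: assoc_graded_def degree_0_def)
qed

lemma degree_0_smult:
  assumes "x \<in> carrier A"
  shows "degree_0 (c \<odot>\<^bsub>A\<^esub> x) = c \<odot>\<^bsub>assoc_graded A F\<^esub> degree_0 x"
proof (rule ext)
  fix n
  have "Fb n +> (c \<odot>\<^bsub>A\<^esub> y) = Fb n" if "y \<in> Fb n" for y
    by (rule Fb.a_rcos_const[OF Fb_smult[OF that]])
  moreover have "Fb n \<noteq> {}" using additive_subgroup.zero_closed[OF Fb_additive] by blast
  ultimately have "(\<Union>y\<in>Fb n. Fb n +> (c \<odot>\<^bsub>A\<^esub> y)) = Fb n"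
    by (simp cong: SUP_cong)
  then show "degree_0 (c \<odot>\<^bsub>A\<^esub> x) n = (c \<odot>\<^bsub>assoc_graded A F\<^esub> degree_0 x) n"
    using assms by (cases "n = 0") (simp_all add: assoc_graded_def degree_0_def zero_coset)
qed

end

text \<open>A word without letters from V is a product of letters from kG and collapses to one
  letter. Hence the bottom layer of the filtration is the image of kG.\<close>

lemma (in gen_ideal) deg_le_0_cong_kG:
  assumes "deg_le 0 p" shows "\<exists>a. p \<asymp> in_kG a"
proof -
  have word: "\<exists>a. Poly_Mapping.single (Word xs) 1 \<asymp> in_kG a" if "V_degree (Word xs) = 0" for xs
    using that
  proof (induction xs)
    case Nil
    show ?case using cong_sym[OF kG_one] by (auto simp flip: zero_free_monoid_def)
  next
    case (Cons x xs)
    from Cons.prems obtain b where x: "x = Inl b" and "V_degree (Word xs) = 0"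
      by (cases x) (auto simp: V_degree_def)
    with Cons.IH obtain a where a: "Poly_Mapping.single (Word xs) 1 \<asymp> in_kG a" by blast
    have "Poly_Mapping.single (Word (x # xs)) 1 = in_kG b * Poly_Mapping.single (Word xs) 1"
      by (simp add: in_kG_def x mult_single plus_free_monoid_def)
    also have "\<dots> \<asymp> in_kG b * in_kG a" by (intro cong_mult cong_refl a)
    also have "\<dots> \<asymp> in_kG (b * a)" by (rule cong_sym[OF kG_mult])
    finally show ?case by blast
  qed
  have "\<exists>a. (\<Sum>w\<in>W. Poly_Mapping.single w (Poly_Mapping.lookup p w)) \<asymp> in_kG a"
    if "finite W" "W \<subseteq> Poly_Mapping.keys p" for W
    using that
  proof (induction W)
    case empty
    show ?case using cong_sym[OF kG_0] by auto
  next
    case (insert w W)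
    then obtain a where a: "(\<Sum>w\<in>W. Poly_Mapping.single w (Poly_Mapping.lookup p w)) \<asymp> in_kG a" by auto
    have "V_degree (Word (letters w)) = 0"
      using insert.prems assms by (auto simp: deg_le_def)
    from word[OF this] obtain b where b: "Poly_Mapping.single w 1 \<asymp> in_kG b" by auto
    let ?c = "Poly_Mapping.lookup p w"
    have "(\<Sum>w\<in>insert w W. Poly_Mapping.single w (Poly_Mapping.lookup p w)) =
      coeff_scale (*) ?c (Poly_Mapping.single w 1) + (\<Sum>w\<in>W. Poly_Mapping.single w (Poly_Mapping.lookup p w))"
      using insert by (simp add: coeff_scale_single)
    also have "\<dots> \<asymp> coeff_scale (*) ?c (in_kG b) + in_kG a"
      by (intro cong_add cong_scale a b)
    also have "\<dots> \<asymp> in_kG (coeff_scale (*) ?c b) + in_kG a"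
      by (intro cong_add cong_refl cong_sym[OF kG_scale])
    also have "\<dots> \<asymp> in_kG (coeff_scale (*) ?c b + a)" by (rule cong_sym[OF kG_add])
    finally show ?case by blast
  qed
  from this[OF finite_keys order_refl] show ?thesis by (simp add: sum_single_lookup)
qed

text \<open>The projection S(V) \<rtimes> G \<rightarrow> kG that kills V, given on letters. It is a
  left inverse of kG \<rightarrow> S(V) \<rtimes> G and shows that degree 0 there is no smaller than
  kG.\<close>

definition kill_V :: "('g \<Rightarrow>\<^sub>0 'k) + 'v \<Rightarrow> ('g::group_add \<Rightarrow>\<^sub>0 'k::field)" where
  "kill_V x = (case x of Inl a \<Rightarrow> a | Inr v \<Rightarrow> 0)"

text \<open>Every term of the skew relations contains a letter from V and goes to 0. In H the terms
  from \<lambda> and \<kappa> may survive, so this projection does not descend to H in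
  general.\<close>

lemma kill_V_skew_ideal:
  assumes "p \<in> relation_ideal sV (skew_relations act)"
  shows "free_eval kill_V p = 0"
proof -
  have "free_eval kill_V p \<in> {0}"
    by (rule relation_ideal_eval[OF _ _ _ _ _ assms])
      (auto simp: generator_relations_def skew_relations_def free_eval_hom kill_V_def coeff_scale_zero_right)
  then show ?thesis by simp
qed

lemma gen_ideal_relation_ideal: "gen_ideal sV (relation_ideal sV R)"
  using relation_ideal_contains[of sV R]
  by (intro gen_ideal.intro relation_ideal_free_ideal gen_ideal_axioms.intro) auto

text \<open>
  In degree 0 the PBW isomorphism is a linear surjection from the image of \<open>kG\<close> onto a space that
  maps onto \<open>kG\<close>. Being an endomorphism of a finite dimensional space, the composite with
  \<open>kG\<close> is injective.
\<close>

lemma PBW_kG_injective: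
  fixes sV :: "'k::field \<Rightarrow> 'v::ab_group_add \<Rightarrow> 'v" and act :: "'g::{group_add,finite} \<Rightarrow> 'v \<Rightarrow> 'v"
  assumes "PBW_deformation sV act lam \<kappa>"
    and a: "in_kG a \<in> relation_ideal sV (H_relations act lam \<kappa>)"
  shows "a = 0"
proof -
  define J where "J = relation_ideal sV (H_relations act lam \<kappa>)"
  define I :: "('g, 'k, 'v) tens set" where "I = relation_ideal sV (skew_relations act)"
  define F where "F = H_filtration sV act lam \<kappa>"
  interpret J: gen_ideal sV J unfolding J_def by (rule gen_ideal_relation_ideal)
  interpret I: gen_ideal sV I unfolding I_def by (rule gen_ideal_relation_ideal)
  interpret H: filtered_algebra J.Q F
    using presented_filtered_algebra[of sV "H_relations act lam \<kappa>"]
    by (simp add: J_def F_def presented_algebra_def H_filtration_def)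
  have F_eq: "F n = J.cls ` {p. deg_le n p}" for n
    by (simp add: F_def H_filtration_def degree_le_eq J_def)
  \<comment> \<open>In the lowest degree the conditions \<open>= 0\<close> and
    \<open>\<le> 0\<close> coincide, so this component of the grading can be handled by
    \<open>deg_le\<close>.\<close>
  have skew_0: "skew_grading sV act 0 = I.cls ` {p. deg_le 0 p}"
    by (simp add: skew_grading_def degree_eq_def deg_le_def I.cls_def flip: I_def)
  have skew: "skew_group_algebra sV act = I.Q"
    by (simp add: skew_group_algebra_def presented_algebra_def I_def)
  obtain \<theta> where \<theta>: "\<theta> \<in> algebra_iso (assoc_graded J.Q F) I.Q"
    and \<theta>_0: "\<theta> ` assoc_graded_component J.Q F 0 = I.cls ` {p. deg_le 0 p}"
    using assms(1) unfolding PBW_deformation_def graded_isomorphic_def Let_def skew F_def[symmetric] skew_0[symmetric]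
    by (auto simp: H_algebra_def presented_algebra_def J_def)
  \<comment> \<open>These assemble the chain \<open>kG \<rightarrow> F\<^sub>0 \<rightarrow>
    gr\<^sub>0 \<rightarrow> (S(V) \<rtimes> G)\<^sub>0 \<rightarrow> kG\<close>: \<open>s\<close>
    is the part up to gr, \<open>r\<close> picks a representative of the image under \<theta>, and
    \<open>T\<close> below is the whole composite.\<close>
  define s where "s = (\<lambda>a. H.degree_0 (J.cls (in_kG a)))"
  define r where "r = (\<lambda>a. SOME p. \<theta> (s a) = I.cls p)"
  have s_comp: "s a \<in> assoc_graded_component J.Q F 0" for a
    unfolding s_def by (rule H.degree_0_component) (auto simp: F_eq deg_le_in_kG)
  then have s_carrier: "s a \<in> carrier (assoc_graded J.Q F)" for a
    by (auto simp: assoc_graded_component_def)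
  have r: "\<theta> (s a) = I.cls (r a)" for a
  proof -
    have "\<exists>p. \<theta> (s a) = I.cls p" using s_comp[of a] \<theta>_0 by blast
    then show ?thesis unfolding r_def by (rule someI_ex)
  qed
  define T where "T = (\<lambda>a. free_eval kill_V (r a))"
  have T: "T a = free_eval kill_V p" if "\<theta> (s a) = I.cls p" for a p
  proof -
    have "r a - p \<in> I" using that by (simp add: r I.cls_eq_iff)
    then have "free_eval kill_V (r a - p) = 0" unfolding I_def by (rule kill_V_skew_ideal)
    then show ?thesis by (simp add: T_def free_eval_diff)
  qed
  have "T (a + b) = T a + T b" for a b
  proof -
    have "J.cls (in_kG (a + b)) = J.cls (in_kG a) \<oplus>\<^bsub>J.Q\<^esub> J.cls (in_kG b)"
      using J.kG_add[of a b] by (simp add: J.Q_add J.cls_eq_iff J.cong_def)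
    then have "s (a + b) = s a \<oplus>\<^bsub>assoc_graded J.Q F\<^esub> s b"
      by (simp add: s_def H.degree_0_add J.cls_carrier)
    then have "\<theta> (s (a + b)) = I.cls (r a + r b)"
      using \<theta> s_carrier ring_hom_add[of \<theta> "assoc_graded J.Q F" I.Q "s a" "s b"]
      by (simp add: algebra_iso_def ring_iso_def r I.Q_add)
    from T[OF this] show ?thesis by (simp add: free_eval_add T_def)
  qed
  moreover have "T (coeff_scale (*) c a) = coeff_scale (*) c (T a)" for c a
  proof -
    have "J.cls (in_kG (coeff_scale (*) c a)) = c \<odot>\<^bsub>J.Q\<^esub> J.cls (in_kG a)"
      using J.kG_scale[of c a] by (simp add: J.Q_smult J.cls_eq_iff J.cong_def)
    then have "s (coeff_scale (*) c a) = c \<odot>\<^bsub>assoc_graded J.Q F\<^esub> s a"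
      by (simp add: s_def H.degree_0_smult J.cls_carrier)
    then have "\<theta> (s (coeff_scale (*) c a)) = I.cls (coeff_scale (*) c (r a))"
      using \<theta> s_carrier by (simp add: algebra_iso_def r I.Q_smult)
    from T[OF this] show ?thesis by (simp add: free_eval_scale T_def)
  qed
  moreover have "surj T"
  proof (rule surjI)
    fix b
    have "I.cls (in_kG b) \<in> \<theta> ` assoc_graded_component J.Q F 0"
      by (simp add: \<theta>_0 deg_le_in_kG)
    then obtain t where t: "t \<in> assoc_graded_component J.Q F 0" "I.cls (in_kG b) = \<theta> t" by blast
    obtain x where "x \<in> F 0" "t = H.degree_0 x" by (rule H.degree_0_component_cases[OF t(1)])
    then obtain p where p: "deg_le 0 p" "t = H.degree_0 (J.cls p)" by (auto simp: F_eq)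
    \<comment> \<open>Every class of degree 0 in H comes from kG, so \<theta> restricted to the
      image of \<open>s\<close> still reaches all of degree 0.\<close>
    obtain a where "p - in_kG a \<in> J" using J.deg_le_0_cong_kG[OF p(1)] by (auto simp: J.cong_def)
    then have "t = s a" using p(2) by (simp add: s_def flip: J.cls_eq_iff)
    then have "\<exists>a. \<theta> (s a) = I.cls (in_kG b)" using t(2) by auto
    then have "\<theta> (s (SOME a. \<theta> (s a) = I.cls (in_kG b))) = I.cls (in_kG b)" by (rule someI_ex)
    from T[OF this] show "T (SOME a. \<theta> (s a) = I.cls (in_kG b)) = b"
      by (simp add: kill_V_def)
  qed
  ultimately have "inj T" by (rule coeff_scale_linear_surj_imp_inj)
  moreover have "T a = T 0"
  proof -
    have "in_kG a - in_kG 0 \<in> J"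
      using a J.kG_0 J.mem_diff by (auto simp: J_def[symmetric] J.cong_def)
    then have "s a = s 0" by (simp add: s_def flip: J.cls_eq_iff)
    then show ?thesis by (simp add: T_def r_def)
  qed
  ultimately show "a = 0" by (simp add: inj_eq)
qed

section \<open>The change of parameters\<close>

lemma bilinear_map_iff:
  "bilinear_map s1 s2 s3 f \<longleftrightarrow> vector_space s1 \<and> vector_space s2 \<and> vector_space s3 \<and>
    (\<forall>x y z. f x (y + z) = f x y + f x z) \<and> (\<forall>x y z. f (x + y) z = f x z + f y z) \<and>
    (\<forall>c x y. f x (s2 c y) = s3 c (f x y)) \<and> (\<forall>c x y. f (s1 c x) y = s3 c (f x y))"
  unfolding bilinear_map_def Vector_Spaces.linear_iff by blast

locale linear_group_action = vs: vector_space sV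
  for sV :: "'k::field \<Rightarrow> 'v::ab_group_add \<Rightarrow> 'v" +
  fixes act :: "'g::{group_add,finite} \<Rightarrow> 'v \<Rightarrow> 'v"
  assumes linear_action: "linear_action sV act"
begin

lemma act_add: "act g (x + y) = act g x + act g y"
  and act_scale: "act g (sV c x) = sV c (act g x)"
  and act_zero: "act 0 x = x"
  and act_plus: "act (g + h) x = act g (act h x)"
  using linear_action by (auto simp: linear_action_def Vector_Spaces.linear_iff)

lemma lookup_coeff_scale_V: "Poly_Mapping.lookup (coeff_scale sV c s) g = sV c (Poly_Mapping.lookup s g)"
  by (simp add: coeff_scale_def Poly_Mapping.map.rep_eq when_def)

lemma coeff_scale_V_add: "coeff_scale sV c (s + t) = coeff_scale sV c s + coeff_scale sV c t"
  and coeff_scale_V_diff: "coeff_scale sV c (s - t) = coeff_scale sV c s - coeff_scale sV c t"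
  by (rule poly_mapping_eqI, simp add: lookup_coeff_scale_V lookup_add lookup_minus vs.scale_right_distrib
      vs.scale_right_diff_distrib)+

lemma twist_add_left: "twist sV f (a + b) v = twist sV f a v + twist sV f b v"
  by (rule poly_mapping_eqI) (simp add: lookup_twist lookup_add vs.scale_left_distrib)

lemma twist_uminus_left: "twist sV f (- a) v = - twist sV f a v"
  by (rule poly_mapping_eqI) (simp add: lookup_twist)

lemma twist_scale_left: "twist sV f (coeff_scale (*) c a) v = coeff_scale sV c (twist sV f a v)"
  by (rule poly_mapping_eqI) (simp add: lookup_twist lookup_coeff_scale lookup_coeff_scale_V)

lemma twist_add_right:
  "twist sV act a (v + w) = twist sV act a v + twist sV act a w"
  "twist sV (\<lambda>_ v. v) a (v + w) = twist sV (\<lambda>_ v. v) a v + twist sV (\<lambda>_ v. v) a w"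
  by (rule poly_mapping_eqI, simp add: lookup_twist lookup_add act_add vs.scale_right_distrib)+

lemma twist_scale_right:
  "twist sV act a (sV c v) = coeff_scale sV c (twist sV act a v)"
  "twist sV (\<lambda>_ v. v) a (sV c v) = coeff_scale sV c (twist sV (\<lambda>_ v. v) a v)"
  by (rule poly_mapping_eqI, simp add: lookup_twist lookup_coeff_scale_V act_scale mult.commute)+

lemmas twist_simps = twist_add_left twist_uminus_left twist_scale_left twist_add_right twist_scale_right

end

lemma contract_uminus: "contract (\<lambda>v. - \<gamma> v) s = - contract \<gamma> s"
  by (simp add: contract_def sum_negf)

section \<open>The shift of parameters by \<gamma> and its inverse\<close>

locale parameter_shift = linear_group_action sV act
  for sV :: "'k::field \<Rightarrow> 'v::ab_group_add \<Rightarrow> 'v" and act :: "'g::{group_add,finite} \<Rightarrow> 'v \<Rightarrow> 'v" +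
  fixes \<gamma> :: "'v \<Rightarrow> ('g \<Rightarrow>\<^sub>0 'k)"
  assumes \<gamma>_add: "\<gamma> (x + y) = \<gamma> x + \<gamma> y"
    and \<gamma>_scale: "\<gamma> (sV c x) = coeff_scale (*) c (\<gamma> x)"
begin

lemma \<gamma>_diff: "\<gamma> (x - y) = \<gamma> x - \<gamma> y"
  using \<gamma>_add[of "x - y" y] by simp

lemma \<gamma>_uminus: "\<gamma> (- x) = - \<gamma> x"
  using \<gamma>_diff[of 0 x] \<gamma>_diff[of 0 0] by simp

lemma contract_uminus_right: "contract \<gamma> (- s) = - contract \<gamma> s"
  by (simp add: contract_def \<gamma>_uminus sum_negf)

lemma contract_add: "contract \<gamma> (s + t) = contract \<gamma> s + contract \<gamma> t"
  by (simp add: contract_def lookup_add \<gamma>_add distrib_right sum.distrib)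

lemma contract_diff: "contract \<gamma> (s - t) = contract \<gamma> s - contract \<gamma> t"
  by (simp add: contract_def lookup_minus \<gamma>_diff left_diff_distrib sum_subtractf)

lemma contract_scale: "contract \<gamma> (coeff_scale sV c s) = coeff_scale (*) c (contract \<gamma> s)"
  by (simp add: contract_def lookup_coeff_scale_V \<gamma>_scale coeff_scale_mult_left coeff_scale_sum)

lemma contract_twist: "contract \<gamma> (twist sV f a v) =
  (\<Sum>g\<in>UNIV. coeff_scale (*) (Poly_Mapping.lookup a g) (\<gamma> (f g v) * Poly_Mapping.single g 1))"
  by (simp add: contract_def lookup_twist \<gamma>_scale coeff_scale_mult_left)

lemma contract_tensor: "contract \<gamma> (twist sV (\<lambda>_ v. v) a v) = \<gamma> v * a"
  by (simp add: contract_twist coeff_scale_mult_right sum_coeff_scale_single flip: sum_distrib_left)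

text \<open>As \<open>twist\<close> does not involve \<gamma> and \<open>contract\<close> is odd in
  it, the two corrections cancel. The inverse homomorphism thus needs no calculation of its
  own.\<close>

lemma shift_lam_uminus: "shift_lam sV act (\<lambda>v. - \<gamma> v) (shift_lam sV act \<gamma> lam) = lam"
  by (simp add: shift_lam_def contract_uminus fun_eq_iff)

lemma shift_linear_part_uminus:
  "shift_linear_part sV act (\<lambda>v. - \<gamma> v) v w = - shift_linear_part sV act \<gamma> v w"
  by (simp add: shift_linear_part_def twist_uminus_left)

lemma contract_shift_linear_part: "contract \<gamma> (shift_linear_part sV act \<gamma> v w) =
  \<gamma> v * \<gamma> w - \<gamma> w * \<gamma> v + contract \<gamma> (twist sV act (\<gamma> v) w) - contract \<gamma> (twist sV act (\<gamma> w) v)"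
  by (simp add: shift_linear_part_def contract_add contract_diff contract_tensor)

text \<open>The commutator of \<gamma>(v) and \<gamma>(w) arises once in each shift. It is removed
  by the shifted \<lambda> and by the contraction of the linear correction, and the twisted
  contractions cancel as well.\<close>

lemma shift_kappa_uminus:
  assumes "\<And>a v. lam (- a) v = - lam a v"
  shows "shift_kappa sV act (\<lambda>v. - \<gamma> v) (shift_lam sV act \<gamma> lam) (shift_kappa sV act \<gamma> lam \<kappa>) = \<kappa>"
proof (intro ext)
  fix v w
  show "shift_kappa sV act (\<lambda>v. - \<gamma> v) (shift_lam sV act \<gamma> lam) (shift_kappa sV act \<gamma> lam \<kappa>) v w = \<kappa> v w"
    by (rule prod_eqI)
      (simp_all add: shift_kappa_def shift_linear_part_uminus contract_uminus contract_add
        contract_shift_linear_part shift_lam_def assms twist_uminus_left contract_uminus_right algebra_simps)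
qed

lemma shift_kappa_bilinear:
  assumes lam: "bilinear_map (coeff_scale (*)) sV (coeff_scale (*)) lam"
    and \<kappa>: "bilinear_map sV sV (kappa_scale sV) \<kappa>"
  shows "bilinear_map sV sV (kappa_scale sV) (shift_kappa sV act \<gamma> lam \<kappa>)"
proof -
  have *: "lam a (v + w) = lam a v + lam a w" "lam (a + b) v = lam a v + lam b v"
    "lam a (sV c v) = coeff_scale (*) c (lam a v)" "lam (coeff_scale (*) c a) v = coeff_scale (*) c (lam a v)"
    for a b c v w using lam by (auto simp: bilinear_map_iff)
  have **: "\<kappa> x (v + w) = \<kappa> x v + \<kappa> x w" "\<kappa> (v + w) x = \<kappa> v x + \<kappa> w x"
    "\<kappa> x (sV c v) = kappa_scale sV c (\<kappa> x v)" "\<kappa> (sV c v) x = kappa_scale sV c (\<kappa> v x)"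
    for c v w x using \<kappa> by (auto simp: bilinear_map_iff)
  have L: "shift_linear_part sV act \<gamma> x (y + z) = shift_linear_part sV act \<gamma> x y + shift_linear_part sV act \<gamma> x z"
    "shift_linear_part sV act \<gamma> (y + z) x = shift_linear_part sV act \<gamma> y x + shift_linear_part sV act \<gamma> z x"
    "shift_linear_part sV act \<gamma> x (sV c y) = coeff_scale sV c (shift_linear_part sV act \<gamma> x y)"
    "shift_linear_part sV act \<gamma> (sV c y) x = coeff_scale sV c (shift_linear_part sV act \<gamma> y x)" for x y z c
    by (simp_all add: shift_linear_part_def \<gamma>_add \<gamma>_scale twist_simps coeff_scale_V_add coeff_scale_V_diff)
  have "vector_space sV" "vector_space (kappa_scale sV :: 'k \<Rightarrow> ('g \<Rightarrow>\<^sub>0 'k) \<times> ('g \<Rightarrow>\<^sub>0 'v) \<Rightarrow> _)"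
    using \<kappa> by (auto simp: bilinear_map_iff)
  then show ?thesis
    unfolding bilinear_map_iff
    by (auto simp: shift_kappa_def * ** L contract_add contract_scale \<gamma>_add \<gamma>_scale kappa_scale_def
        coeff_scale_add coeff_scale_diff coeff_scale_V_add coeff_scale_mult_left
        simp flip: coeff_scale_mult_left coeff_scale_mult_right
        intro!: prod_eqI)
      (simp_all add: algebra_simps)
qed

text \<open>Both directions get used: one is the claimed isomorphism, the other transports the PBW
  property. Linearity of the shifted \<lambda> is immediate in the application, where that function
  is zero.\<close>

lemma filtered_algebra_iso_shift:
  fixes lam :: "('g \<Rightarrow>\<^sub>0 'k) \<Rightarrow> 'v \<Rightarrow> ('g \<Rightarrow>\<^sub>0 'k)"
    and \<kappa> :: "'v \<Rightarrow> 'v \<Rightarrow> ('g \<Rightarrow>\<^sub>0 'k) \<times> ('g \<Rightarrow>\<^sub>0 'v)"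
  assumes lam: "\<And>a b v. lam (a + b) v = lam a v + lam b v"
      "\<And>c a v. lam (coeff_scale (*) c a) v = coeff_scale (*) c (lam a v)"
    and lam': "\<And>a b v. shift_lam sV act \<gamma> lam (a + b) v = shift_lam sV act \<gamma> lam a v + shift_lam sV act \<gamma> lam b v"
      "\<And>c a v. shift_lam sV act \<gamma> lam (coeff_scale (*) c a) v = coeff_scale (*) c (shift_lam sV act \<gamma> lam a v)"
  defines "R \<equiv> H_relations act lam \<kappa>"
    and "R' \<equiv> H_relations act (shift_lam sV act \<gamma> lam) (shift_kappa sV act \<gamma> lam \<kappa>)"
  shows "\<exists>\<phi>. filtered_algebra_iso (presented_algebra sV R') (degree_le sV R')
      (presented_algebra sV R) (degree_le sV R) \<phi>"
    and "\<exists>\<phi>. filtered_algebra_iso (presented_algebra sV R) (degree_le sV R)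
      (presented_algebra sV R') (degree_le sV R') \<phi>"
proof -
  let ?J = "relation_ideal sV R" and ?J' = "relation_ideal sV R'"
  let ?f = "shift_letter \<gamma>" and ?f' = "shift_letter (\<lambda>v. - \<gamma> v)"
  interpret J: gen_ideal sV ?J by (rule gen_ideal_relation_ideal)
  interpret J': gen_ideal sV ?J' by (rule gen_ideal_relation_ideal)
  interpret H: H_ideal sV ?J act lam \<kappa>
    by unfold_locales (use relation_ideal_contains[of sV R] in \<open>auto simp: R_def lam\<close>)
  interpret H': H_ideal sV ?J' act "shift_lam sV act \<gamma> lam" "shift_kappa sV act \<gamma> lam \<kappa>"
    by unfold_locales (use relation_ideal_contains[of sV R'] in \<open>auto simp: R'_def lam'\<close>)
  have lam_minus: "lam (- a) v = - lam a v" for a v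
    using lam(1)[of a "- a" v] lam(1)[of 0 0 v] by (simp add: eq_neg_iff_add_eq_0 add.commute)
  have f: "free_eval ?f p \<in> ?J" if "p \<in> ?J'" for p
    by (rule H.shift_eval) (use that in \<open>simp_all add: R'_def \<gamma>_add \<gamma>_scale\<close>)
  have scale_minus: "coeff_scale (*) c (- a) = - coeff_scale (*) c a" for c and a :: "'g \<Rightarrow>\<^sub>0 'k"
    by (simp add: coeff_scale_times)
  \<comment> \<open>The same substitution lemma, now for -\<gamma> and the shifted parameters;
    shifting back returns \<open>lam\<close> and \<open>\<kappa>\<close>.\<close>
  have f': "free_eval ?f' p \<in> ?J'" if "p \<in> ?J" for p
    by (rule H'.shift_eval)
      (use that in \<open>simp_all add: R_def \<gamma>_add \<gamma>_scale scale_minus shift_lam_uminus shift_kappa_uminus lam_minus\<close>)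
  have ff': "free_eval ?f' (?f x) - Poly_Mapping.single (Word [x]) 1 \<in> ?J'" for x
  proof (cases x)
    case (Inl a)
    then show ?thesis by (simp add: J'.mem_0 flip: in_kG_def)
  next
    case (Inr v)
    \<comment> \<open>The elements \<gamma>(v) and -\<gamma>(v) enter as letters, and their
      cancellation is a consequence of the additivity relations in the ideal.\<close>
    have "in_kG (- \<gamma> v) + in_kG (\<gamma> v) - in_kG 0 \<in> ?J'"
      using J'.cong_sym[OF J'.kG_add[of "- \<gamma> v" "\<gamma> v"]] by (simp add: J'.cong_def)
    then have "in_kG (- \<gamma> v) + in_kG (\<gamma> v) \<in> ?J'"
      using J'.mem_add J'.kG_0 by (fastforce simp: J'.cong_def)
    then show ?thesis by (simp add: Inr free_eval_hom flip: in_V_def)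
  qed
  have f'f: "free_eval ?f (?f' x) - Poly_Mapping.single (Word [x]) 1 \<in> ?J" for x
  proof (cases x)
    case (Inl a)
    then show ?thesis by (simp add: J.mem_0 flip: in_kG_def)
  next
    case (Inr v)
    have "in_kG (\<gamma> v) + in_kG (- \<gamma> v) - in_kG 0 \<in> ?J"
      using J.cong_sym[OF J.kG_add[of "\<gamma> v" "- \<gamma> v"]] by (simp add: J.cong_def)
    then have "in_kG (\<gamma> v) + in_kG (- \<gamma> v) \<in> ?J"
      using J.mem_add J.kG_0 by (fastforce simp: J.cong_def)
    then show ?thesis by (simp add: Inr free_eval_hom flip: in_V_def)
  qed
  have deg: "deg_le (V_degree (Word [x])) (shift_letter \<delta> x :: ('g, 'k, 'v) tens)" for \<delta> x
    by (cases x) (use deg_le_in_V in \<open>auto simp: V_degree_def intro!: deg_le_add deg_le_in_kG\<close>)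
  show "\<exists>\<phi>. filtered_algebra_iso (presented_algebra sV R') (degree_le sV R')
      (presented_algebra sV R) (degree_le sV R) \<phi>"
    by (rule presented_filtered_isomorphic[OF f f' ff' f'f deg deg])
  show "\<exists>\<phi>. filtered_algebra_iso (presented_algebra sV R) (degree_le sV R)
      (presented_algebra sV R') (degree_le sV R') \<phi>"
    by (rule presented_filtered_isomorphic[OF f' f f'f ff' deg deg])
qed

end

section \<open>Averaging\<close>

text \<open>The two ways of moving \<open>gh\<close> past \<open>v\<close> agree in \<open>H\<close>, and hence in \<open>kG\<close> if \<open>kG\<close> embeds.\<close>

lemma (in H_ideal) lam_cocycle:
  assumes inj: "\<And>a. in_kG a \<in> J \<Longrightarrow> a = 0" and act: "act (g + h) v = act g (act h v)"
  shows "lam (Poly_Mapping.single (g + h) 1) v =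
    Poly_Mapping.single g 1 * lam (Poly_Mapping.single h 1) v +
    lam (Poly_Mapping.single g 1) (act h v) * Poly_Mapping.single h 1"
    (is "?l = ?eg * ?lh + ?lg * ?eh")
proof -
  let ?V = "in_V (act g (act h v)) :: ('g, 'k, 'v) tens"
  have gh: "in_G g * in_G h \<asymp> in_G (g + h)"
    using cong_sym[OF kG_mult[of ?eg ?eh]] by (simp add: mult_single in_G_def)
  have "in_kG ?l \<asymp> in_G (g + h) * in_V v - ?V * in_G (g + h)"
    using cong_diff[OF group_relation[of "g + h" v] cong_refl[of "?V * in_G (g + h)"]]
    by (simp add: act) (rule cong_sym, simp)
  also have "\<dots> \<asymp> in_G g * in_G h * in_V v - ?V * (in_G g * in_G h)"
    by (intro cong_diff cong_mult cong_refl cong_sym[OF gh])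
  also have "\<dots> = in_G g * (in_G h * in_V v) - ?V * in_G g * in_G h"
    by (simp add: mult.assoc)
  also have "\<dots> \<asymp> in_G g * (in_V (act h v) * in_G h + in_kG ?lh) - ?V * in_G g * in_G h"
    by (intro cong_diff cong_mult cong_refl group_relation)
  also have "\<dots> = (in_G g * in_V (act h v)) * in_G h + in_G g * in_kG ?lh - ?V * in_G g * in_G h"
    by (simp add: algebra_simps)
  also have "\<dots> \<asymp> (?V * in_G g + in_kG ?lg) * in_G h + in_G g * in_kG ?lh - ?V * in_G g * in_G h"
    by (intro cong_diff cong_add cong_mult cong_refl group_relation)
  also have "\<dots> = in_kG ?eg * in_kG ?lh + in_kG ?lg * in_kG ?eh"
    by (simp add: algebra_simps in_G_def)
  also have "\<dots> \<asymp> in_kG (?eg * ?lh) + in_kG (?lg * ?eh)"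
    by (intro cong_add cong_sym[OF kG_mult])
  also have "\<dots> \<asymp> in_kG (?eg * ?lh + ?lg * ?eh)" by (rule cong_sym[OF kG_add])
  finally have "in_kG ?l - in_kG (?eg * ?lh + ?lg * ?eh) \<asymp> 0" by (simp add: cong_def)
  \<comment> \<open>So far the identity lives in H. Collected into one letter congruent to 0, it can
    be pulled back to kG by \<open>inj\<close>.\<close>
  then have "in_kG (?l - (?eg * ?lh + ?lg * ?eh)) \<asymp> 0" by (rule cong_trans[OF kG_diff])
  then have "?l - (?eg * ?lh + ?lg * ?eh) = 0" by (intro inj) (simp add: mem_iff_cong_0)
  then show ?thesis by simp
qed

definition averaged_lam ::
    "('g::{group_add,finite} \<Rightarrow> 'v \<Rightarrow> 'v) \<Rightarrow> (('g \<Rightarrow>\<^sub>0 'k::field) \<Rightarrow> 'v \<Rightarrow> ('g \<Rightarrow>\<^sub>0 'k)) \<Rightarrow> 'v \<Rightarrow> ('g \<Rightarrow>\<^sub>0 'k)" where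
  "averaged_lam act lam v = coeff_scale (*) (inverse (of_nat (card (UNIV :: 'g set))))
     (\<Sum>g\<in>UNIV. lam (Poly_Mapping.single g 1) (act (- g) v) * Poly_Mapping.single (- g) 1)"

text \<open>Multiplication by h permutes the summands of the average up to the cocycle identity, at
  the price of one copy of \<lambda>(h, v) per summand. The normalisation turns these |G| copies
  into a single one.\<close>

lemma (in linear_group_action) averaged_lam_cobounds:
  fixes lam :: "('g \<Rightarrow>\<^sub>0 'k) \<Rightarrow> 'v \<Rightarrow> ('g \<Rightarrow>\<^sub>0 'k)"
  assumes card: "of_nat (card (UNIV :: 'g set)) \<noteq> (0::'k)"
    and cocycle: "\<And>g h v. lam (Poly_Mapping.single (g + h) 1) v =
      Poly_Mapping.single g 1 * lam (Poly_Mapping.single h 1) v +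
      lam (Poly_Mapping.single g 1) (act h v) * Poly_Mapping.single h 1"
  shows "lam (Poly_Mapping.single h 1) v + Poly_Mapping.single h 1 * averaged_lam act lam v
    = averaged_lam act lam (act h v) * Poly_Mapping.single h 1"
proof -
  let ?n = "of_nat (card (UNIV :: 'g set)) :: 'k"
  let ?e = "\<lambda>g. Poly_Mapping.single g (1::'k)"
  let ?l = "lam (?e h) v"
  have act_cancel: "act g (act (- g) x) = x" for g x
    by (simp add: act_zero flip: act_plus)
  \<comment> \<open>The cocycle identity for h and g at the vector g\<inverse>\<cdot>v, multiplied
    by g\<inverse> from the right.\<close>
  have "?e h * (lam (?e g) (act (- g) v) * ?e (- g)) =
      lam (?e (h + g)) (act (- (h + g)) (act h v)) * ?e (- (h + g)) * ?e h - ?l" for g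
  proof -
    have "act (- (h + g)) (act h v) = act (- g) v"
      by (simp add: minus_add add.assoc flip: act_plus)
    moreover have "?e (- (h + g)) * ?e h = ?e (- g)"
      by (simp add: mult_single minus_add add.assoc)
    moreover have "lam (?e (h + g)) (act (- g) v) * ?e (- g) =
        ?e h * lam (?e g) (act (- g) v) * ?e (- g) + ?l * (?e g * ?e (- g))"
      by (simp add: cocycle act_cancel distrib_right mult.assoc)
    ultimately show ?thesis
      by (simp add: mult.assoc) (simp add: mult_single)
  qed
  then have "?e h * (\<Sum>g\<in>UNIV. lam (?e g) (act (- g) v) * ?e (- g)) =
      (\<Sum>g\<in>UNIV. lam (?e (h + g)) (act (- (h + g)) (act h v)) * ?e (- (h + g))) * ?e h - (\<Sum>g\<in>(UNIV :: 'g set). ?l)"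
    by (simp add: sum_distrib_left sum_distrib_right sum_subtractf)
  also have "(\<Sum>g\<in>UNIV. lam (?e (h + g)) (act (- (h + g)) (act h v)) * ?e (- (h + g))) =
      (\<Sum>g\<in>UNIV. lam (?e g) (act (- g) (act h v)) * ?e (- g))"
    by (rule sum.reindex_bij_witness[of _ "\<lambda>g. - h + g" "\<lambda>g. h + g"]) (simp_all add: add.assoc[symmetric])
  also have "(\<Sum>g\<in>(UNIV :: 'g set). ?l) = coeff_scale (*) ?n ?l"
    by (simp add: coeff_scale_times)
  finally have sum: "?e h * (\<Sum>g\<in>UNIV. lam (?e g) (act (- g) v) * ?e (- g)) =
      (\<Sum>g\<in>UNIV. lam (?e g) (act (- g) (act h v)) * ?e (- g)) * ?e h - coeff_scale (*) ?n ?l" .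
  \<comment> \<open>Invertibility of |G| is used here; with the default \<open>inverse 0 = 0\<close>
    this term would be lost.\<close>
  have "coeff_scale (*) (inverse ?n) (coeff_scale (*) ?n ?l) = ?l"
    using card by (intro poly_mapping_eqI) (simp add: lookup_coeff_scale)
  then have "?e h * averaged_lam act lam v = averaged_lam act lam (act h v) * ?e h - ?l"
    unfolding averaged_lam_def
    by (simp only: coeff_scale_mult_right[symmetric] sum coeff_scale_diff) (simp add: coeff_scale_mult_left)
  then show ?thesis by simp
qed

theorem theorem7p1:
  fixes sV :: "'k::field \<Rightarrow> 'v::ab_group_add \<Rightarrow> 'v" and B :: "'v set"
    and act :: "'g::{group_add,finite} \<Rightarrow> 'v \<Rightarrow> 'v"
    and lam :: "('g \<Rightarrow>\<^sub>0 'k) \<Rightarrow> 'v \<Rightarrow> ('g \<Rightarrow>\<^sub>0 'k)"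
    and \<kappa> :: "'v \<Rightarrow> 'v \<Rightarrow> ('g \<Rightarrow>\<^sub>0 'k) \<times> ('g \<Rightarrow>\<^sub>0 'v)"
  assumes "CHAR('k) \<noteq> 2"
    and "finite_dimensional_vector_space sV B"
    and "linear_action sV act"
    and "\<not> CHAR('k) dvd card (UNIV :: 'g set)"
    and "bilinear_map (coeff_scale (*)) sV (coeff_scale (*)) lam"
    and "bilinear_map sV sV (kappa_scale sV) \<kappa>"
    and "PBW_deformation sV act lam \<kappa>"
  shows "\<exists>\<kappa>' :: 'v \<Rightarrow> 'v \<Rightarrow> ('g \<Rightarrow>\<^sub>0 'k) \<times> ('g \<Rightarrow>\<^sub>0 'v).
           bilinear_map sV sV (kappa_scale sV) \<kappa>' \<and>
           filtered_isomorphic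
             (H_algebra sV act lam \<kappa>) (H_filtration sV act lam \<kappa>)
             (H_algebra sV act (\<lambda>_ _. 0) \<kappa>') (H_filtration sV act (\<lambda>_ _. 0) \<kappa>') \<and>
           PBW_deformation sV act (\<lambda>_ _. 0) \<kappa>'"
proof -
  have lam: "lam a (v + w) = lam a v + lam a w" "lam (a + b) v = lam a v + lam b v"
    "lam a (sV c v) = coeff_scale (*) c (lam a v)" "lam (coeff_scale (*) c a) v = coeff_scale (*) c (lam a v)"
    for a b c v w using assms(5) by (auto simp: bilinear_map_iff)
  have vs: "vector_space sV" using assms(6) by (auto simp: bilinear_map_iff)
  interpret linear_group_action sV act
    by (intro linear_group_action.intro linear_group_action_axioms.intro vs assms(3))
  let ?J = "relation_ideal sV (H_relations act lam \<kappa>)"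
  interpret J: gen_ideal sV ?J by (rule gen_ideal_relation_ideal)
  interpret H: H_ideal sV ?J act lam \<kappa>
    by unfold_locales (use relation_ideal_contains[of sV "H_relations act lam \<kappa>"] in \<open>auto simp: lam\<close>)
  define \<gamma> where "\<gamma> = averaged_lam act lam"
  have scale_comm: "coeff_scale (*) c (coeff_scale (*) d a) = coeff_scale (*) d (coeff_scale (*) c a)"
    for c d and a :: "'g \<Rightarrow>\<^sub>0 'k"
    by (rule poly_mapping_eqI) (simp add: lookup_coeff_scale)
  interpret parameter_shift sV act \<gamma>
  proof
    show "\<gamma> (v + w) = \<gamma> v + \<gamma> w" for v w
      by (simp add: \<gamma>_def averaged_lam_def act_add lam distrib_right sum.distrib coeff_scale_add)
    show "\<gamma> (sV c v) = coeff_scale (*) c (\<gamma> v)" for c v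
      unfolding \<gamma>_def averaged_lam_def scale_comm[of c]
      by (simp add: act_scale lam coeff_scale_sum coeff_scale_mult_left)
  qed
  \<comment> \<open>Characteristic 0 is included, since \<open>0 dvd n\<close> holds only for
    \<open>n = 0\<close>.\<close>
  have card: "of_nat (card (UNIV :: 'g set)) \<noteq> (0::'k)"
    using assms(4) by (simp add: of_nat_eq_0_iff_char_dvd)
  have cobound: "lam (Poly_Mapping.single h 1) v + Poly_Mapping.single h 1 * \<gamma> v
      = \<gamma> (act h v) * Poly_Mapping.single h 1" for h v
    unfolding \<gamma>_def
    by (rule averaged_lam_cobounds[OF card H.lam_cocycle[OF PBW_kG_injective[OF assms(7)] act_plus]])
  have zero: "shift_lam sV act \<gamma> lam = (\<lambda>_ _. 0)"
  proof (intro ext)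
    fix a :: "'g \<Rightarrow>\<^sub>0 'k" and v
    let ?c = "Poly_Mapping.lookup a" and ?e = "\<lambda>g. Poly_Mapping.single g (1::'k)"
    \<comment> \<open>Everything is linear in \<open>a\<close>, so the identity on group elements
      gives vanishing on all of kG.\<close>
    have "lam a v + a * \<gamma> v = lam (\<Sum>g\<in>UNIV. coeff_scale (*) (?c g) (?e g)) v
        + (\<Sum>g\<in>UNIV. coeff_scale (*) (?c g) (?e g)) * \<gamma> v"
      by (simp add: sum_coeff_scale_single)
    also have "\<dots> = (\<Sum>g\<in>UNIV. coeff_scale (*) (?c g) (lam (?e g) v + ?e g * \<gamma> v))"
      by (simp add: H.lam_sum_left lam sum_distrib_right coeff_scale_add sum.distrib coeff_scale_mult_left)
    also have "\<dots> = contract \<gamma> (twist sV act a v)"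
      by (simp add: cobound contract_twist)
    finally show "shift_lam sV act \<gamma> lam a v = 0" by (simp add: shift_lam_def)
  qed
  define \<kappa>' where "\<kappa>' = shift_kappa sV act \<gamma> lam \<kappa>"
  note iso = filtered_algebra_iso_shift[of lam \<kappa>, unfolded zero, folded \<kappa>'_def]
  obtain \<phi> where \<phi>: "filtered_algebra_iso (H_algebra sV act (\<lambda>_ _. 0) \<kappa>') (H_filtration sV act (\<lambda>_ _. 0) \<kappa>')
      (H_algebra sV act lam \<kappa>) (H_filtration sV act lam \<kappa>) \<phi>"
    using iso(1) by (auto simp: H_algebra_def H_filtration_def lam coeff_scale_zero_right)
  obtain \<psi> where \<psi>: "filtered_algebra_iso (H_algebra sV act lam \<kappa>) (H_filtration sV act lam \<kappa>)
      (H_algebra sV act (\<lambda>_ _. 0) \<kappa>') (H_filtration sV act (\<lambda>_ _. 0) \<kappa>') \<psi>"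
    using iso(2) by (auto simp: H_algebra_def H_filtration_def lam coeff_scale_zero_right)
  show ?thesis
  proof (intro exI conjI)
    show "bilinear_map sV sV (kappa_scale sV) \<kappa>'"
      unfolding \<kappa>'_def by (rule shift_kappa_bilinear[OF assms(5,6)])
    show "filtered_isomorphic (H_algebra sV act lam \<kappa>) (H_filtration sV act lam \<kappa>)
        (H_algebra sV act (\<lambda>_ _. 0) \<kappa>') (H_filtration sV act (\<lambda>_ _. 0) \<kappa>')"
      unfolding filtered_isomorphic_def
      using filtered_algebra_iso.iso[OF \<psi>] filtered_algebra_iso.image_F[OF \<psi>] by blast
    \<comment> \<open>The associated graded algebra of the new algebra is isomorphic to that of H,
      and hence by hypothesis to S(V) \<rtimes> G.\<close>
    show "PBW_deformation sV act (\<lambda>_ _. 0) \<kappa>'"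
      using graded_isomorphic_trans[OF filtered_algebra_iso.assoc_graded_isomorphic[OF \<phi>]] assms(7)
      unfolding PBW_deformation_def Let_def by blast
  qed
qed

end
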